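(* Let $p\ge0$ be fixed, and for $k\ge2$ consider the trend statistic \[ K(x_1,\dots,x_k)=\sum_{\Delta=1}^{k-1}\sum_{j=1}^{k-\Delta}\alpha_\Delta\operatorname{sgn}(x_{\Delta+j}-x_j) \] with power weights $\alpha_\Delta=\Delta^p$. Then the relative incremental index is decreasing in $k$ and is given by \[ I_k(K)=\frac{(k-1)^{2p}}{\sum_{\Delta=1}^{k-1}(k-\Delta)^2\Delta^{2p}} . \] Moreover, $I_k(K)\asymp k^{-3}$ as $k\to\infty$ (i.e. $I_k(K)k^3$ is bounded above and bounded below away from $0$).
   Context: Let $\nu$ be an absolutely continuous probability measure on $\mathbb R$, $\pi_k=\nu^{\otimes k}$, let $\mathcal H_k$ be the mean-zero functions in $L^2(\mathbb R^k,\pi_k)$ with norm $\|\cdot\|$, let $X_1,X_2,\dots$ be i.i.d. with law $\nu$, and $Y_i=(X_i,\dots,X_{i+k-1})$. For $f\in\mathcal H_k$ the asymptotic variance is $\sigma^2(f)=\operatorname{Var}(f(Y_1))+2\sum_{r=1}^{k-1}\operatorname{Cov}(f(Y_1),f(Y_{1+r}))$. Let $P$ be given by $Pf(x_1,\dots,x_k)=\int f(x_2,\dots,x_k,\xi)\,\nu(d\xi)$, $B_k=I+P+P^*+\cdots+P^{k-1}+(P^* )^{k-1}$, and let $\mathcal L_1$ be the eigenspace of $B_k$ in $\mathcal H_k$ for eigenvalue $1$; equivalently, the set of $f\in\mathcal H_k$ with $\int f\,\nu(dx_1)=0$ and $\int f\,\nu(dx_k)=0$. The incremental component $f^{\mathrm{inc}}$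 is the orthogonal projection of $f$ onto $\mathcal L_1$, and the relative incremental index is $I_k(f)=\|f^{\mathrm{inc}}\|^2/\sigma^2(f)$. *)

theory Defs
  imports "HOL-Probability.Probability" "HOL-Library.Landau_Symbols"
begin

text \<open>A point \<open>(x\<^sub>1, \<dots>, x\<^sub>k)\<close> of \<open>k\<close>-dimensional space is a function on the index set
  \<open>{1..k}\<close>, extensional (i.e. \<open>undefined\<close> outside \<open>{1..k}\<close>).\<close>

definition prod_law :: "real measure \<Rightarrow> nat \<Rightarrow> (nat \<Rightarrow> real) measure" where
  "prod_law \<nu> k = PiM {1..k} (\<lambda>_. \<nu>)"

definition L2_inner :: "'b measure \<Rightarrow> ('b \<Rightarrow> real) \<Rightarrow> ('b \<Rightarrow> real) \<Rightarrow> real" where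
  "L2_inner M f g = (\<integral>x. f x * g x \<partial>M)"

definition L2_norm :: "'b measure \<Rightarrow> ('b \<Rightarrow> real) \<Rightarrow> real" where
  "L2_norm M f = sqrt (L2_inner M f f)"

text \<open>Elements of \<open>L\<^sup>2\<close> are represented by functions instead of classes of functions;
  equality in \<open>L\<^sup>2\<close> is equality almost everywhere.\<close>

definition H_space :: "real measure \<Rightarrow> nat \<Rightarrow> ((nat \<Rightarrow> real) \<Rightarrow> real) set" where
  "H_space \<nu> k = {f \<in> borel_measurable (prod_law \<nu> k).
     integrable (prod_law \<nu> k) (\<lambda>x. (f x)\<^sup>2) \<and> (\<integral>x. f x \<partial>prod_law \<nu> k) = 0}"

definition P_op :: "real measure \<Rightarrow> nat \<Rightarrow> ((nat \<Rightarrow> real) \<Rightarrow> real) \<Rightarrow> (nat \<Rightarrow> real) \<Rightarrow> real" where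
  "P_op \<nu> k f = (\<lambda>x. \<integral>\<xi>. f (\<lambda>j\<in>{1..k}. if j = k then \<xi> else x (j + 1)) \<partial>\<nu>)"

text \<open>The adjoint on \<open>H\<close> is unique up to almost everywhere equality, as is the orthogonal
  projection below; \<open>L1_space\<close> and the norm of \<open>incr_component\<close> do not depend on the choice made by \<open>SOME\<close>.\<close>

definition adjoint_on ::
  "'b measure \<Rightarrow> ('b \<Rightarrow> real) set \<Rightarrow> (('b \<Rightarrow> real) \<Rightarrow> ('b \<Rightarrow> real)) \<Rightarrow> ('b \<Rightarrow> real) \<Rightarrow> ('b \<Rightarrow> real)" where
  "adjoint_on M H T = (SOME S. (\<forall>g\<in>H. S g \<in> H) \<and>
     (\<forall>f\<in>H. \<forall>g\<in>H. L2_inner M (T f) g = L2_inner M f (S g)))"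

definition P_adj :: "real measure \<Rightarrow> nat \<Rightarrow> ((nat \<Rightarrow> real) \<Rightarrow> real) \<Rightarrow> (nat \<Rightarrow> real) \<Rightarrow> real" where
  "P_adj \<nu> k = adjoint_on (prod_law \<nu> k) (H_space \<nu> k) (P_op \<nu> k)"

definition B_op :: "real measure \<Rightarrow> nat \<Rightarrow> ((nat \<Rightarrow> real) \<Rightarrow> real) \<Rightarrow> (nat \<Rightarrow> real) \<Rightarrow> real" where
  "B_op \<nu> k f = (\<lambda>x. f x + (\<Sum>r=1..k-1. (P_op \<nu> k ^^ r) f x + (P_adj \<nu> k ^^ r) f x))"

definition L1_space :: "real measure \<Rightarrow> nat \<Rightarrow> ((nat \<Rightarrow> real) \<Rightarrow> real) set" where
  "L1_space \<nu> k = {f \<in> H_space \<nu> k. AE x in prod_law \<nu> k. B_op \<nu> k f x = 1 * f x}"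

definition orth_proj :: "'b measure \<Rightarrow> ('b \<Rightarrow> real) set \<Rightarrow> ('b \<Rightarrow> real) \<Rightarrow> ('b \<Rightarrow> real)" where
  "orth_proj M S f = (SOME g. g \<in> S \<and> (\<forall>h\<in>S. L2_inner M (\<lambda>x. f x - g x) h = 0))"

definition incr_component ::
  "real measure \<Rightarrow> nat \<Rightarrow> ((nat \<Rightarrow> real) \<Rightarrow> real) \<Rightarrow> (nat \<Rightarrow> real) \<Rightarrow> real" where
  "incr_component \<nu> k f = orth_proj (prod_law \<nu> k) (L1_space \<nu> k) f"

definition covar :: "'a measure \<Rightarrow> ('a \<Rightarrow> real) \<Rightarrow> ('a \<Rightarrow> real) \<Rightarrow> real" where
  "covar M U V = prob_space.expectation M
     (\<lambda>\<omega>. (U \<omega> - prob_space.expectation M U) * (V \<omega> - prob_space.expectation M V))"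

definition block :: "nat \<Rightarrow> (nat \<Rightarrow> 'a \<Rightarrow> real) \<Rightarrow> nat \<Rightarrow> 'a \<Rightarrow> nat \<Rightarrow> real" where
  "block k X i \<omega> = (\<lambda>j\<in>{1..k}. X (i + j - 1) \<omega>)"

definition asymp_var ::
  "'a measure \<Rightarrow> (nat \<Rightarrow> 'a \<Rightarrow> real) \<Rightarrow> nat \<Rightarrow> ((nat \<Rightarrow> real) \<Rightarrow> real) \<Rightarrow> real" where
  "asymp_var M X k f =
     prob_space.variance M (\<lambda>\<omega>. f (block k X 1 \<omega>)) +
     2 * (\<Sum>r=1..k-1. covar M (\<lambda>\<omega>. f (block k X 1 \<omega>)) (\<lambda>\<omega>. f (block k X (1 + r) \<omega>)))"

definition incr_index ::
  "real measure \<Rightarrow> 'a measure \<Rightarrow> (nat \<Rightarrow> 'a \<Rightarrow> real) \<Rightarrow> nat \<Rightarrow> ((nat \<Rightarrow> real) \<Rightarrow> real) \<Rightarrow> real" where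
  "incr_index \<nu> M X k f =
     (L2_norm (prod_law \<nu> k) (incr_component \<nu> k f))\<^sup>2 / asymp_var M X k f"

definition trend_stat :: "(nat \<Rightarrow> real) \<Rightarrow> nat \<Rightarrow> (nat \<Rightarrow> real) \<Rightarrow> real" where
  "trend_stat \<alpha> k x = (\<Sum>\<Delta>=1..k-1. \<Sum>j=1..k-\<Delta>. \<alpha> \<Delta> * sgn (x (\<Delta> + j) - x j))"

end

theory Submission
  imports Defs
begin

text \<open>Put \<open>h(a) = E sgn (a - \<xi>)\<close> and \<open>s(a, b) = sgn (b - a) - h(b) + h(a)\<close>. For i.i.d. atomless
  variables the functions \<open>h(x\<^sub>i)\<close> and \<open>s(x\<^sub>i, x\<^sub>j)\<close>, \<open>i < j\<close>, are centred and orthogonal with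
  squared norm \<open>1/3\<close>, and the trend statistic expands in them; the coefficients of the
  \<open>h(x\<^sub>i)\<close> sum to zero. The operator \<open>P\<close> moves a family of translates
  \<open>s(x\<^sub>i, x\<^bsub>i+d\<^esub>)\<close>, \<open>1 \<le> i \<le> k - d\<close>, one step forward and kills its last member;
  \<open>P\<^sup>*\<close> moves it one step backward. Hence \<open>B\<close> acts on the family as the all-ones matrix,
  and its eigenvalue \<open>1\<close> only sees families of length one: the incremental component is the
  single term \<open>\<alpha>\<^bsub>k-1\<^esub> s(x\<^sub>1, x\<^sub>k)\<close>. In the asymptotic variance the lagged covariances
  add up, for each \<open>d\<close>, to a third of the squared sum of the coefficients, which is
  \<open>((k - d) \<alpha>\<^sub>d)\<^sup>2\<close>.\<close>

subsection \<open>Averaging operators and the adjoint of \<open>P\<close>\<close>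

lemma integrable_mult_L2:
  fixes f g :: "'a \<Rightarrow> real"
  assumes [measurable]: "f \<in> borel_measurable N" "g \<in> borel_measurable N"
    and "integrable N (\<lambda>x. (f x)\<^sup>2)" "integrable N (\<lambda>x. (g x)\<^sup>2)"
  shows "integrable N (\<lambda>x. f x * g x)"
proof (rule Bochner_Integration.integrable_bound)
  show "integrable N (\<lambda>x. (f x)\<^sup>2 + (g x)\<^sup>2)" using assms by simp
  show "AE x in N. norm (f x * g x) \<le> norm ((f x)\<^sup>2 + (g x)\<^sup>2)"
  proof (rule AE_I2)
    fix x
    have "\<bar>f x * g x\<bar> \<le> (f x)\<^sup>2 + (g x)\<^sup>2"
    proof -
      have "2 * (\<bar>f x\<bar> * \<bar>g x\<bar>) \<le> (f x)\<^sup>2 + (g x)\<^sup>2"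
        using sum_squares_bound[of "\<bar>f x\<bar>" "\<bar>g x\<bar>"] by simp
      moreover have "0 \<le> \<bar>f x\<bar> * \<bar>g x\<bar>" by simp
      ultimately show ?thesis unfolding abs_mult by linarith
    qed
    then show "norm (f x * g x) \<le> norm ((f x)\<^sup>2 + (g x)\<^sup>2)" by simp
  qed
qed simp

lemma abs_sgn_le: "\<bar>sgn (a::real)\<bar> \<le> 1"
  by (simp add: sgn_real_def)

lemma abs_mult_le_one: "\<bar>a\<bar> \<le> 1 \<Longrightarrow> \<bar>b\<bar> \<le> 1 \<Longrightarrow> \<bar>a * b\<bar> \<le> (1::real)"
  by (simp add: abs_mult mult_le_one)

lemma L2_inner_commute: "L2_inner N f g = L2_inner N g f"
  by (simp add: L2_inner_def mult.commute)

lemma L2_inner_cong_AE: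
  assumes "AE x in N. a x = b x" and [measurable]: "f \<in> borel_measurable N" "a \<in> borel_measurable N" "b \<in> borel_measurable N"
  shows "L2_inner N f a = L2_inner N f b"
  unfolding L2_inner_def using assms(1) by (intro integral_cong_AE) auto

text \<open>One abstraction serves \<open>P\<close> and its adjoint: \<open>\<tau>\<close> combines
  a fresh variable with an old point, and \<open>distr_eq\<close> says that the result again has law
  \<open>N\<close>. Invariance alone gives that averaging preserves means and stays in the
  square-integrable functions.\<close>

locale averaging = \<nu>: prob_space \<nu> + N: prob_space N
  for \<nu> :: "'b measure" and N :: "'c measure" +
  fixes \<tau> :: "'b \<times> 'c \<Rightarrow> 'c"
  assumes meas [measurable]: "\<tau> \<in> measurable (\<nu> \<Otimes>\<^sub>M N) N"
    and distr_eq: "distr (\<nu> \<Otimes>\<^sub>M N) N \<tau> = N"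
begin

sublocale pair_prob_space \<nu> N ..

definition avg :: "('c \<Rightarrow> real) \<Rightarrow> 'c \<Rightarrow> real" where
  "avg f x = (\<integral>\<xi>. f (\<tau> (\<xi>, x)) \<partial>\<nu>)"

context
  fixes f :: "'c \<Rightarrow> real"
  assumes f [measurable]: "f \<in> borel_measurable N" and f2: "integrable N (\<lambda>x. (f x)\<^sup>2)"
begin

lemma integrable_sq_pullback: "integrable (\<nu> \<Otimes>\<^sub>M N) (\<lambda>w. (f (\<tau> w))\<^sup>2)"
  by (rule integrable_distr[OF meas]) (simp add: distr_eq f2)

lemma integrable_pullback: "integrable (\<nu> \<Otimes>\<^sub>M N) (\<lambda>w. f (\<tau> w))"
  by (rule square_integrable_imp_integrable[OF _ integrable_sq_pullback]) measurable

lemma measurable_avg [measurable]: "avg f \<in> borel_measurable N"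
  unfolding avg_def by measurable

lemma integral_avg: "(\<integral>x. avg f x \<partial>N) = (\<integral>x. f x \<partial>N)"
proof -
  have "(\<integral>x. avg f x \<partial>N) = (\<integral>w. f (\<tau> w) \<partial>(\<nu> \<Otimes>\<^sub>M N))"
    unfolding avg_def using integral_snd[of "\<lambda>\<xi> x. f (\<tau> (\<xi>, x))"] integrable_pullback by (simp add: case_prod_beta')
  also have "\<dots> = (\<integral>x. f x \<partial>distr (\<nu> \<Otimes>\<^sub>M N) N \<tau>)" by (rule integral_distr[symmetric]) measurable
  finally show ?thesis by (simp add: distr_eq)
qed

lemma integrable_avg_sq: "integrable N (\<lambda>x. (avg f x)\<^sup>2)"
proof (rule Bochner_Integration.integrable_bound)
  show "integrable N (\<lambda>x. \<integral>\<xi>. (f (\<tau> (\<xi>, x)))\<^sup>2 \<partial>\<nu>)"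
    using integrable_snd[of "\<lambda>\<xi> x. (f (\<tau> (\<xi>, x)))\<^sup>2"] integrable_sq_pullback by (simp add: case_prod_beta')
  have "AE x in N. integrable \<nu> (\<lambda>\<xi>. (f (\<tau> (\<xi>, x)))\<^sup>2)"
    using AE_integrable_snd[of "\<lambda>\<xi> x. (f (\<tau> (\<xi>, x)))\<^sup>2"] integrable_sq_pullback by (simp add: case_prod_beta')
  with AE_space show "AE x in N. norm ((avg f x)\<^sup>2) \<le> norm (\<integral>\<xi>. (f (\<tau> (\<xi>, x)))\<^sup>2 \<partial>\<nu>)"
  proof eventually_elim
    case (elim x)
    have [measurable]: "(\<lambda>\<xi>. f (\<tau> (\<xi>, x))) \<in> borel_measurable \<nu>" using elim(1) by measurable
    have "integrable \<nu> (\<lambda>\<xi>. f (\<tau> (\<xi>, x)))"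
      by (rule \<nu>.square_integrable_imp_integrable[OF _ elim(2)]) measurable
    \<comment> \<open>Jensen's inequality for the square, read off from the nonnegativity of a
      variance.\<close>
    from \<nu>.variance_eq[OF this elim(2)] \<nu>.variance_positive[of "\<lambda>\<xi>. f (\<tau> (\<xi>, x))"]
    have "(avg f x)\<^sup>2 \<le> (\<integral>\<xi>. (f (\<tau> (\<xi>, x)))\<^sup>2 \<partial>\<nu>)" unfolding avg_def by simp
    then show ?case by simp
  qed
qed measurable

lemma inner_avg:
  assumes [measurable]: "g \<in> borel_measurable N" and g2: "integrable N (\<lambda>x. (g x)\<^sup>2)"
  shows "L2_inner N (avg f) g = (\<integral>(\<xi>, x). f (\<tau> (\<xi>, x)) * g x \<partial>(\<nu> \<Otimes>\<^sub>M N))"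
proof -
  have "integrable (\<nu> \<Otimes>\<^sub>M N) (\<lambda>w. (g (snd w))\<^sup>2)"
  proof -
    interpret Q: pair_prob_space N \<nu> ..
    have "integrable (N \<Otimes>\<^sub>M \<nu>) (\<lambda>w. (g (fst w))\<^sup>2)"
      by (rule integrable_distr[OF measurable_fst]) (simp add: \<nu>.distr_pair_fst g2)
    from Q.integrable_product_swap[OF this] show ?thesis by (simp add: case_prod_beta')
  qed
  then have *: "integrable (\<nu> \<Otimes>\<^sub>M N) (\<lambda>w. f (\<tau> w) * g (snd w))"
    by (intro integrable_mult_L2 integrable_sq_pullback) measurable
  then have "(\<integral>x. (\<integral>\<xi>. f (\<tau> (\<xi>, x)) * g x \<partial>\<nu>) \<partial>N) = (\<integral>(\<xi>, x). f (\<tau> (\<xi>, x)) * g x \<partial>(\<nu> \<Otimes>\<^sub>M N))"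
    using integral_snd[of "\<lambda>\<xi> x. f (\<tau> (\<xi>, x)) * g x"] by (simp add: case_prod_beta')
  then show ?thesis by (simp add: L2_inner_def avg_def)
qed

end
end

section \<open>Shifts of an i.i.d. vector as measure-preserving maps\<close>

locale law = \<nu>: prob_space \<nu> for \<nu> :: "real measure" +
  assumes sets_law [measurable_cong]: "sets \<nu> = sets borel"
begin

lemma space_law [simp]: "space \<nu> = UNIV" using sets_eq_imp_space_eq[OF sets_law] by simp

sublocale P: product_prob_space "\<lambda>_::nat. \<nu>" UNIV ..

lemma prob_space_prod_law: "prob_space (prod_law \<nu> k)"
  unfolding prod_law_def by (intro prob_space_PiM \<nu>.prob_space_axioms)

definition right_shift :: "nat \<Rightarrow> real \<times> (nat \<Rightarrow> real) \<Rightarrow> nat \<Rightarrow> real" where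
  "right_shift k = (\<lambda>(\<xi>, x). \<lambda>j\<in>{1..k}. if j = k then \<xi> else x (j + 1))"

text \<open>Averaging over this map is the explicit candidate for the adjoint of \<open>P\<close>:
  the fresh variable enters at the front instead of at the back.\<close>

definition left_shift :: "nat \<Rightarrow> real \<times> (nat \<Rightarrow> real) \<Rightarrow> nat \<Rightarrow> real" where
  "left_shift k = (\<lambda>(\<xi>, x). \<lambda>j\<in>{1..k}. if j = 1 then \<xi> else x (j - 1))"

lemma distr_insert:
  "distr (\<nu> \<Otimes>\<^sub>M PiM I (\<lambda>_. \<nu>)) (PiM (insert i I) (\<lambda>_. \<nu>)) (\<lambda>(\<xi>, x). x(i := \<xi>)) = PiM (insert i I) (\<lambda>_. \<nu>)"
  by (rule distr_pair_PiM_eq_PiM) (rule \<nu>.prob_space_axioms)+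

lemma distr_reindex:
  "inj_on f I \<Longrightarrow> f \<in> I \<rightarrow> J \<Longrightarrow>
    distr (PiM J (\<lambda>_. \<nu>)) (PiM I (\<lambda>_. \<nu>)) (\<lambda>x. \<lambda>n\<in>I. x (f n)) = PiM I (\<lambda>_. \<nu>)"
  using distr_PiM_reindex[of J "\<lambda>_. \<nu>" f I] \<nu>.prob_space_axioms by simp

lemma measurable_insert:
  "(\<lambda>(\<xi>, x). x(i := \<xi>)) \<in> measurable (\<nu> \<Otimes>\<^sub>M PiM I (\<lambda>_. \<nu>)) (PiM (insert i I) (\<lambda>_. \<nu>))"
  unfolding case_prod_beta' by (rule measurable_fun_upd[where J=I]) auto

lemma measurable_reindex:
  "f \<in> I \<rightarrow> J \<Longrightarrow>
    (\<lambda>x. \<lambda>n\<in>I. x (f n)) \<in> measurable (PiM J (\<lambda>_. \<nu>)) (PiM I (\<lambda>_. \<nu>))"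
  by (intro measurable_restrict measurable_component_singleton) auto

text \<open>Attaching an independent coordinate and then relabelling injectively keeps an i.i.d.
  vector i.i.d. Both shifts have this form, with fresh index \<open>Suc k\<close> and relabelling
  \<open>Suc\<close>, or fresh index \<open>0\<close> and relabelling by the predecessor.\<close>

lemma distr_insert_reindex:
  assumes "inj_on f I" "f \<in> I \<rightarrow> insert i I"
  shows "(\<lambda>(\<xi>, x). \<lambda>n\<in>I. (x(i := \<xi>)) (f n)) \<in> measurable (\<nu> \<Otimes>\<^sub>M PiM I (\<lambda>_. \<nu>)) (PiM I (\<lambda>_. \<nu>))"
    and "distr (\<nu> \<Otimes>\<^sub>M PiM I (\<lambda>_. \<nu>)) (PiM I (\<lambda>_. \<nu>)) (\<lambda>(\<xi>, x). \<lambda>n\<in>I. (x(i := \<xi>)) (f n)) = PiM I (\<lambda>_. \<nu>)"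
proof -
  let ?r = "\<lambda>x. \<lambda>n\<in>I. x (f n)" and ?u = "\<lambda>(\<xi>, x). x(i := \<xi>)"
  have eq: "(\<lambda>(\<xi>, x). \<lambda>n\<in>I. (x(i := \<xi>)) (f n)) = ?r \<circ> ?u" by (auto simp: fun_eq_iff)
  show "(\<lambda>(\<xi>, x). \<lambda>n\<in>I. (x(i := \<xi>)) (f n)) \<in> measurable (\<nu> \<Otimes>\<^sub>M PiM I (\<lambda>_. \<nu>)) (PiM I (\<lambda>_. \<nu>))"
    unfolding eq by (rule measurable_comp[OF measurable_insert measurable_reindex[OF assms(2)]])
  show "distr (\<nu> \<Otimes>\<^sub>M PiM I (\<lambda>_. \<nu>)) (PiM I (\<lambda>_. \<nu>)) (\<lambda>(\<xi>, x). \<lambda>n\<in>I. (x(i := \<xi>)) (f n)) = PiM I (\<lambda>_. \<nu>)"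
    unfolding eq distr_distr[OF measurable_reindex[OF assms(2)] measurable_insert, symmetric] distr_insert
    by (rule distr_reindex[OF assms])
qed

lemma right_shift_eq: "right_shift k = (\<lambda>(\<xi>, x). \<lambda>n\<in>{1..k}. (x(Suc k := \<xi>)) (Suc n))"
  by (auto simp: right_shift_def fun_eq_iff)

lemma left_shift_eq: "left_shift k = (\<lambda>(\<xi>, x). \<lambda>n\<in>{1..k}. (x(0 := \<xi>)) (n - 1))"
  by (auto simp: left_shift_def fun_eq_iff)

sublocale R: averaging \<nu> "prod_law \<nu> k" "right_shift k" for k
proof (intro averaging.intro averaging_axioms.intro \<nu>.prob_space_axioms prob_space_prod_law)
  show "right_shift k \<in> measurable (\<nu> \<Otimes>\<^sub>M prod_law \<nu> k) (prod_law \<nu> k)"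
    and "distr (\<nu> \<Otimes>\<^sub>M prod_law \<nu> k) (prod_law \<nu> k) (right_shift k) = prod_law \<nu> k"
    unfolding right_shift_eq prod_law_def by (rule distr_insert_reindex; auto)+
qed

sublocale L: averaging \<nu> "prod_law \<nu> k" "left_shift k" for k
proof (intro averaging.intro averaging_axioms.intro \<nu>.prob_space_axioms prob_space_prod_law)
  show "left_shift k \<in> measurable (\<nu> \<Otimes>\<^sub>M prod_law \<nu> k) (prod_law \<nu> k)"
    and "distr (\<nu> \<Otimes>\<^sub>M prod_law \<nu> k) (prod_law \<nu> k) (left_shift k) = prod_law \<nu> k"
    unfolding left_shift_eq prod_law_def by (rule distr_insert_reindex; auto simp: inj_on_def)+
qed

lemma P_op_eq: "P_op \<nu> k = R.avg k"
  by (intro ext) (subst R.avg_def, simp add: P_op_def right_shift_def)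

lemma integral_insert:
  fixes F :: "(nat \<Rightarrow> real) \<Rightarrow> real"
  assumes [measurable]: "F \<in> borel_measurable (PiM (insert i I) (\<lambda>_. \<nu>))"
  shows "(\<integral>w. F w \<partial>PiM (insert i I) (\<lambda>_. \<nu>)) = (\<integral>(\<xi>, x). F (x(i := \<xi>)) \<partial>(\<nu> \<Otimes>\<^sub>M PiM I (\<lambda>_. \<nu>)))"
  by (subst distr_insert[symmetric], subst integral_distr[OF measurable_insert])
    (simp_all add: case_prod_beta')

text \<open>Both sides are the expectation of \<open>f\<close> on the last \<open>k\<close> times
  \<open>g\<close> on the first \<open>k\<close> of \<open>k + 1\<close> i.i.d. variables. They are
  labelled \<open>1\<close> to \<open>k + 1\<close> on one side (\<open>?A\<close>) and
  \<open>0\<close> to \<open>k\<close> on the other (\<open>?B\<close>), and \<open>?t\<close>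
  translates between the labellings.\<close>

lemma inner_right_left:
  assumes f [measurable]: "f \<in> borel_measurable (prod_law \<nu> k)" and f2: "integrable (prod_law \<nu> k) (\<lambda>x. (f x)\<^sup>2)"
    and g [measurable]: "g \<in> borel_measurable (prod_law \<nu> k)" and g2: "integrable (prod_law \<nu> k) (\<lambda>x. (g x)\<^sup>2)"
  shows "L2_inner (prod_law \<nu> k) (R.avg k f) g = L2_inner (prod_law \<nu> k) f (L.avg k g)"
proof -
  let ?A = "insert (Suc k) {1..k}" and ?B = "insert 0 {1..k}"
  let ?a = "\<lambda>w::nat \<Rightarrow> real. \<lambda>n\<in>{1..k}. w n" and ?s = "\<lambda>w::nat \<Rightarrow> real. \<lambda>n\<in>{1..k}. w (Suc n)"
    and ?p = "\<lambda>w::nat \<Rightarrow> real. \<lambda>n\<in>{1..k}. w (n - 1)" and ?t = "\<lambda>w::nat \<Rightarrow> real. \<lambda>n\<in>?B. w (Suc n)"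
  let ?F = "\<lambda>w. f (?s w) * g (?a w)" and ?G = "\<lambda>w. f (?a w) * g (?p w)"
  \<comment> \<open>Points of the product space are extensional, so an update at an index off
    \<open>{1..k}\<close> is undone by restriction.\<close>
  have sp: "(\<lambda>n\<in>{1..k}. (x(i := \<xi>)) n) = x"
    if "x \<in> space (prod_law \<nu> k)" "i \<notin> {1..k}" for x i \<xi>
    using that unfolding prod_law_def space_PiM by (auto simp: PiE_def extensional_def fun_eq_iff)
  have sp': "restrict x {Suc 0..k} = x" if "x \<in> space (prod_law \<nu> k)" for x
    using that unfolding prod_law_def space_PiM by (auto simp: PiE_def extensional_restrict)
  have [measurable]: "?s \<in> measurable (PiM ?A (\<lambda>_. \<nu>)) (prod_law \<nu> k)" "?a \<in> measurable (PiM ?A (\<lambda>_. \<nu>)) (prod_law \<nu> k)"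
    "?a \<in> measurable (PiM ?B (\<lambda>_. \<nu>)) (prod_law \<nu> k)" "?p \<in> measurable (PiM ?B (\<lambda>_. \<nu>)) (prod_law \<nu> k)"
    unfolding prod_law_def by (rule measurable_reindex; auto)+
  have t: "?t \<in> measurable (PiM ?A (\<lambda>_. \<nu>)) (PiM ?B (\<lambda>_. \<nu>))"
    by (rule measurable_reindex) auto
  have "L2_inner (prod_law \<nu> k) (R.avg k f) g = (\<integral>(\<xi>, x). ?F (x(Suc k := \<xi>)) \<partial>(\<nu> \<Otimes>\<^sub>M prod_law \<nu> k))"
    unfolding R.inner_avg[OF f f2 g g2]
    by (intro Bochner_Integration.integral_cong[OF refl])
      (auto simp: space_pair_measure sp sp' right_shift_eq simp del: fun_upd_apply)
  also have "\<dots> = (\<integral>w. ?F w \<partial>PiM ?A (\<lambda>_. \<nu>))"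
    unfolding prod_law_def[of \<nu> k] by (rule integral_insert[symmetric]) measurable
  also have "\<dots> = (\<integral>w. ?G (?t w) \<partial>PiM ?A (\<lambda>_. \<nu>))"
    by (intro Bochner_Integration.integral_cong[OF refl] arg_cong2[where f="(*)"] arg_cong[where f=f] arg_cong[where f=g])
      (auto simp: fun_eq_iff)
  also have "\<dots> = (\<integral>w. ?G w \<partial>distr (PiM ?A (\<lambda>_. \<nu>)) (PiM ?B (\<lambda>_. \<nu>)) ?t)"
    by (rule integral_distr[OF t, symmetric]) measurable
  also have "distr (PiM ?A (\<lambda>_. \<nu>)) (PiM ?B (\<lambda>_. \<nu>)) ?t = PiM ?B (\<lambda>_. \<nu>)"
    by (rule distr_reindex) auto
  also have "(\<integral>w. ?G w \<partial>PiM ?B (\<lambda>_. \<nu>)) = (\<integral>(\<xi>, x). ?G (x(0 := \<xi>)) \<partial>(\<nu> \<Otimes>\<^sub>M prod_law \<nu> k))"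
    unfolding prod_law_def[of \<nu> k] by (rule integral_insert) measurable
  also have "\<dots> = L2_inner (prod_law \<nu> k) (L.avg k g) f"
    unfolding L.inner_avg[OF g g2 f f2]
    by (intro Bochner_Integration.integral_cong[OF refl])
      (auto simp: space_pair_measure sp sp' left_shift_eq simp del: fun_upd_apply)
  finally show ?thesis by (simp add: L2_inner_def mult.commute)
qed

lemma H_spaceD:
  assumes "f \<in> H_space \<nu> k"
  shows "f \<in> borel_measurable (prod_law \<nu> k)" "integrable (prod_law \<nu> k) (\<lambda>x. (f x)\<^sup>2)"
    "(\<integral>x. f x \<partial>prod_law \<nu> k) = 0"
  using assms by (auto simp: H_space_def)

lemma R_avg_H: "f \<in> H_space \<nu> k \<Longrightarrow> R.avg k f \<in> H_space \<nu> k"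
  by (auto simp: H_space_def R.integral_avg R.integrable_avg_sq)

lemma L_avg_H: "f \<in> H_space \<nu> k \<Longrightarrow> L.avg k f \<in> H_space \<nu> k"
  by (auto simp: H_space_def L.integral_avg L.integrable_avg_sq)

lemma integrable_H: "f \<in> H_space \<nu> k \<Longrightarrow> g \<in> H_space \<nu> k \<Longrightarrow> integrable (prod_law \<nu> k) (\<lambda>x. f x * g x)"
  by (intro integrable_mult_L2 H_spaceD)

lemma integrable_H1:
  assumes "f \<in> H_space \<nu> k"
  shows "integrable (prod_law \<nu> k) f"
  by (rule R.N.square_integrable_imp_integrable[OF H_spaceD(1,2)[OF assms]])

lemma diff_H:
  assumes f: "f \<in> H_space \<nu> k" and g: "g \<in> H_space \<nu> k"
  shows "(\<lambda>x. f x - g x) \<in> H_space \<nu> k"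
proof -
  note [measurable] = H_spaceD(1)[OF f] H_spaceD(1)[OF g]
  have "integrable (prod_law \<nu> k) (\<lambda>x. (f x)\<^sup>2 + (g x)\<^sup>2 - 2 * (f x * g x))"
    by (intro Bochner_Integration.integrable_add Bochner_Integration.integrable_diff
        integrable_mult_right integrable_H f g H_spaceD(2)[OF f] H_spaceD(2)[OF g])
  then have "integrable (prod_law \<nu> k) (\<lambda>x. (f x - g x)\<^sup>2)"
    by (simp add: power2_diff mult.assoc)
  moreover have "(\<integral>x. f x - g x \<partial>prod_law \<nu> k) = 0"
    by (subst Bochner_Integration.integral_diff[OF integrable_H1[OF f] integrable_H1[OF g]])
      (simp add: H_spaceD(3)[OF f] H_spaceD(3)[OF g])
  ultimately show ?thesis by (simp add: H_space_def)
qed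

text \<open>Testing with the difference \<open>a - b\<close> itself shows that its norm is zero.
  This pins down an adjoint up to null sets.\<close>

lemma H_eq_AE:
  assumes ab: "a \<in> H_space \<nu> k" "b \<in> H_space \<nu> k"
    and eq: "\<And>f. f \<in> H_space \<nu> k \<Longrightarrow> L2_inner (prod_law \<nu> k) f a = L2_inner (prod_law \<nu> k) f b"
  shows "AE x in prod_law \<nu> k. a x = b x"
proof -
  let ?N = "prod_law \<nu> k"
  define d where "d = (\<lambda>x. a x - b x)"
  have d: "d \<in> H_space \<nu> k" unfolding d_def by (rule diff_H[OF ab])
  have "(\<integral>x. (d x)\<^sup>2 \<partial>?N) = (\<integral>x. d x * a x - d x * b x \<partial>?N)"
    by (rule Bochner_Integration.integral_cong[OF refl]) (simp add: d_def power2_eq_square algebra_simps)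
  also have "\<dots> = L2_inner ?N d a - L2_inner ?N d b"
    unfolding L2_inner_def by (intro Bochner_Integration.integral_diff integrable_H d ab)
  finally have "(\<integral>x. (d x)\<^sup>2 \<partial>?N) = 0" using eq[OF d] by simp
  then have "AE x in ?N. (d x)\<^sup>2 = 0"
    using integral_nonneg_eq_0_iff_AE[of ?N "\<lambda>x. (d x)\<^sup>2"] H_spaceD(2)[OF d] by simp
  then show ?thesis by (simp add: d_def)
qed

text \<open>The adjoint is a \<open>SOME\<close> choice; averaging over \<open>left_shift\<close> is
  a witness, so the two defining properties may be used of whatever was chosen.\<close>

lemma P_adj:
  shows P_adj_H: "g \<in> H_space \<nu> k \<Longrightarrow> P_adj \<nu> k g \<in> H_space \<nu> k"
    and P_adj_inner: "f \<in> H_space \<nu> k \<Longrightarrow> g \<in> H_space \<nu> k \<Longrightarrow>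
      L2_inner (prod_law \<nu> k) (R.avg k f) g = L2_inner (prod_law \<nu> k) f (P_adj \<nu> k g)"
proof -
  let ?Q = "\<lambda>S. (\<forall>g\<in>H_space \<nu> k. S g \<in> H_space \<nu> k) \<and> (\<forall>f\<in>H_space \<nu> k. \<forall>g\<in>H_space \<nu> k.
       L2_inner (prod_law \<nu> k) (P_op \<nu> k f) g = L2_inner (prod_law \<nu> k) f (S g))"
  have "?Q (L.avg k)" unfolding P_op_eq
    by (intro conjI ballI L_avg_H) (assumption | rule inner_right_left[OF H_spaceD(1,2) H_spaceD(1,2)])+
  then have "?Q (P_adj \<nu> k)" unfolding P_adj_def adjoint_on_def by (rule someI[of ?Q])
  then show "g \<in> H_space \<nu> k \<Longrightarrow> P_adj \<nu> k g \<in> H_space \<nu> k"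
    and "f \<in> H_space \<nu> k \<Longrightarrow> g \<in> H_space \<nu> k \<Longrightarrow>
      L2_inner (prod_law \<nu> k) (R.avg k f) g = L2_inner (prod_law \<nu> k) f (P_adj \<nu> k g)"
    by (auto simp: P_op_eq)
qed

text \<open>The chosen adjoint is known only up to null sets. Allowing \<open>a\<close> and
  \<open>b\<close> to differ on a null set makes the statement iterable along powers.\<close>

lemma P_adj_AE:
  assumes "a \<in> H_space \<nu> k" "b \<in> H_space \<nu> k" "AE x in prod_law \<nu> k. a x = b x"
  shows "AE x in prod_law \<nu> k. P_adj \<nu> k a x = L.avg k b x"
proof (rule H_eq_AE)
  fix f assume f: "f \<in> H_space \<nu> k"
  have "L2_inner (prod_law \<nu> k) f (P_adj \<nu> k a) = L2_inner (prod_law \<nu> k) (R.avg k f) a"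
    by (rule P_adj_inner[symmetric, OF f assms(1)])
  also have "\<dots> = L2_inner (prod_law \<nu> k) (R.avg k f) b"
    by (rule L2_inner_cong_AE[OF assms(3) H_spaceD(1)[OF R_avg_H[OF f]] H_spaceD(1)[OF assms(1)] H_spaceD(1)[OF assms(2)]])
  also have "\<dots> = L2_inner (prod_law \<nu> k) f (L.avg k b)"
    by (rule inner_right_left) (rule H_spaceD[OF f] H_spaceD[OF assms(2)])+
  finally show "L2_inner (prod_law \<nu> k) f (P_adj \<nu> k a) = L2_inner (prod_law \<nu> k) f (L.avg k b)" .
qed (simp_all add: P_adj_H L_avg_H assms)

end

subsection \<open>Interaction part of the sign kernel\<close>

context law
begin

sublocale PP: pair_prob_space \<nu> \<nu> ..

lemma prob_law_UNIV [simp]: "measure \<nu> UNIV = 1"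
  using \<nu>.prob_space by simp

text \<open>The function \<open>h\<close> of the overview; for a law without atoms it equals
  \<open>2 * F a - 1\<close>, where \<open>F\<close> is the distribution function.\<close>

definition sgn_mean :: "real \<Rightarrow> real" where
  "sgn_mean a = (\<integral>\<xi>. sgn (a - \<xi>) \<partial>\<nu>)"

text \<open>The second-order Hoeffding component of the kernel \<open>sgn (b - a)\<close>: removing
  the one-variable parts makes the mean vanish in each argument separately.\<close>

definition sgn_inter :: "real \<Rightarrow> real \<Rightarrow> real" where
  "sgn_inter a b = sgn (b - a) - sgn_mean b + sgn_mean a"

lemma measurable_sgn_mean [measurable]: "sgn_mean \<in> borel_measurable borel"
proof -
  have "sgn_mean \<in> borel_measurable \<nu>" unfolding sgn_mean_def by measurable
  then show ?thesis by (simp add: measurable_cong_sets[OF sets_law refl])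
qed

lemma measurable_sgn_inter [measurable]: "case_prod sgn_inter \<in> borel_measurable (borel \<Otimes>\<^sub>M borel)"
  unfolding sgn_inter_def case_prod_beta' by measurable

lemma integrable_bounded:
  fixes f :: "real \<Rightarrow> real"
  assumes "f \<in> borel_measurable borel" "\<And>x. \<bar>f x\<bar> \<le> B"
  shows "integrable \<nu> f"
  using assms by (intro \<nu>.integrable_const_bound[where B=B]) (auto simp: measurable_cong_sets[OF sets_law refl])

lemma abs_sgn_mean_le: "\<bar>sgn_mean a\<bar> \<le> 1"
proof -
  have "\<bar>sgn_mean a\<bar> \<le> (\<integral>\<xi>. \<bar>sgn (a - \<xi>)\<bar> \<partial>\<nu>)"
    unfolding sgn_mean_def using integral_norm_bound[of \<nu> "\<lambda>\<xi>. sgn (a - \<xi>)"] by simp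
  also have "\<dots> \<le> (\<integral>\<xi>. 1 \<partial>\<nu>)"
    by (intro integral_mono integrable_bounded[where B=1]) (auto simp: abs_sgn_le)
  finally show ?thesis by simp
qed

lemma abs_sgn_inter_le: "\<bar>sgn_inter a b\<bar> \<le> 3"
  using abs_sgn_mean_le[of a] abs_sgn_mean_le[of b] abs_sgn_le[of "b - a"]
  unfolding sgn_inter_def by linarith

lemma integral_swap:
  fixes F :: "real \<Rightarrow> real \<Rightarrow> real"
  assumes [measurable]: "case_prod F \<in> borel_measurable (borel \<Otimes>\<^sub>M borel)" and "\<And>x y. \<bar>F x y\<bar> \<le> B"
  shows "(\<integral>y. (\<integral>x. F x y \<partial>\<nu>) \<partial>\<nu>) = (\<integral>x. (\<integral>y. F x y \<partial>\<nu>) \<partial>\<nu>)"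
proof (rule PP.Fubini_integral)
  show "integrable (\<nu> \<Otimes>\<^sub>M \<nu>) (case_prod F)"
    using assms(2) by (intro PP.integrable_const_bound[where B=B]) (auto simp: measurable_cong_sets[OF sets_pair_measure_cong[OF sets_law sets_law] refl])
qed

lemma integral_sgn: "(\<integral>\<xi>. sgn (\<xi> - a) \<partial>\<nu>) = - sgn_mean a"
proof -
  have "(\<integral>\<xi>. sgn (\<xi> - a) \<partial>\<nu>) = (\<integral>\<xi>. - sgn (a - \<xi>) \<partial>\<nu>)"
    by (rule Bochner_Integration.integral_cong[OF refl]) (simp add: sgn_real_def)
  then show ?thesis by (simp add: sgn_mean_def)
qed

text \<open>Exchanging the two independent variables flips the sign of the double integral.\<close>

lemma integral_sgn_mean: "(\<integral>x. sgn_mean x \<partial>\<nu>) = 0"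
proof -
  have "(\<integral>x. sgn_mean x \<partial>\<nu>) = (\<integral>y. (\<integral>x. sgn (x - y) \<partial>\<nu>) \<partial>\<nu>)"
    unfolding sgn_mean_def by (rule integral_swap[where B=1, symmetric]) (auto simp: abs_sgn_le)
  then show ?thesis by (simp add: integral_sgn)
qed

lemma integrable_sgn_mean: "integrable \<nu> sgn_mean"
  by (rule integrable_bounded[OF _ abs_sgn_mean_le]) measurable

lemma integrable_sgn_mean_sq: "integrable \<nu> (\<lambda>a. (sgn_mean a)\<^sup>2)"
proof (rule integrable_bounded)
  show "\<bar>(sgn_mean a)\<^sup>2\<bar> \<le> 1" for a
    using abs_mult_le_one[OF abs_sgn_mean_le[of a] abs_sgn_mean_le[of a]] by (simp add: power2_eq_square)
qed measurable

lemma integrable_sgn: "integrable \<nu> (\<lambda>x. sgn (x - a))" "integrable \<nu> (\<lambda>x. sgn (a - x))"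
  by (rule integrable_bounded[where B=1]; simp add: abs_sgn_le)+

lemma integral_sgn_inter_right: "(\<integral>\<xi>. sgn_inter a \<xi> \<partial>\<nu>) = 0"
  unfolding sgn_inter_def using integrable_sgn integrable_sgn_mean
  by (simp add: integral_sgn integral_sgn_mean)

lemma integral_sgn_inter_left: "(\<integral>\<xi>. sgn_inter \<xi> a \<partial>\<nu>) = 0"
  unfolding sgn_inter_def using integrable_sgn integrable_sgn_mean
  by (simp add: sgn_mean_def[symmetric] integral_sgn_mean)

text \<open>Labelling by the gap \<open>d\<close> makes a time shift act on \<open>i\<close> alone.
  Gap \<open>0\<close> is free to carry the one-variable terms, because
  \<open>sgn_inter a a = 0\<close>.\<close>

definition basis_fun :: "nat \<Rightarrow> nat \<Rightarrow> (nat \<Rightarrow> real) \<Rightarrow> real" where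
  "basis_fun d i x = (if d = 0 then sgn_mean (x i) else sgn_inter (x i) (x (i + d)))"

lemma abs_basis_fun_le: "\<bar>basis_fun d i x\<bar> \<le> 3"
  using abs_sgn_inter_le abs_sgn_mean_le[of "x i"] by (auto simp: basis_fun_def)

lemma measurable_basis_fun:
  assumes "i \<in> J" "i + d \<in> J"
  shows "basis_fun d i \<in> borel_measurable (PiM J (\<lambda>_. \<nu>))"
proof -
  have [measurable]: "(\<lambda>x. x i) \<in> borel_measurable (PiM J (\<lambda>_. \<nu>))"
    "(\<lambda>x. x (i + d)) \<in> borel_measurable (PiM J (\<lambda>_. \<nu>))"
    using assms by (auto intro!: measurable_PiM_component_rev simp: measurable_cong_sets[OF sets_law refl])
  show ?thesis unfolding basis_fun_def sgn_inter_def by measurable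
qed

text \<open>This degeneracy is the source of the centring, of the orthogonality and of the
  disappearance of a term shifted past the end of the block.\<close>

lemma integral_basis_fun_upd:
  assumes "p \<in> {i, i + d}"
  shows "(\<integral>\<xi>. basis_fun d i (x(p := \<xi>)) \<partial>\<nu>) = 0"
  using assms
  by (cases "d = 0") (auto simp: basis_fun_def integral_sgn_mean integral_sgn_inter_left integral_sgn_inter_right)

lemma integrable_PiM_bounded:
  fixes F :: "(nat \<Rightarrow> real) \<Rightarrow> real"
  assumes "F \<in> borel_measurable (PiM J (\<lambda>_. \<nu>))" "\<And>x. \<bar>F x\<bar> \<le> B"
  shows "integrable (PiM J (\<lambda>_. \<nu>)) F"
proof -
  interpret J: prob_space "PiM J (\<lambda>_. \<nu>)" by (intro prob_space_PiM \<nu>.prob_space_axioms)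
  show ?thesis using assms by (intro J.integrable_const_bound[where B=B]) auto
qed

lemma integral_PiM_fold:
  fixes F :: "(nat \<Rightarrow> real) \<Rightarrow> real"
  assumes "F \<in> borel_measurable (PiM J (\<lambda>_. \<nu>))" "\<And>x. \<bar>F x\<bar> \<le> B" "finite J" "p \<in> J"
  shows "(\<integral>x. F x \<partial>PiM J (\<lambda>_. \<nu>)) = (\<integral>x. (\<integral>\<xi>. F (x(p := \<xi>)) \<partial>\<nu>) \<partial>PiM (J - {p}) (\<lambda>_. \<nu>))"
  using P.product_integral_insert[of "J - {p}" p F] integrable_PiM_bounded[OF assms(1,2)] assms(3,4)
  by (simp add: insert_absorb)

lemma integral_basis_fun:
  assumes "finite J" "i \<in> J" "i + d \<in> J"
  shows "(\<integral>x. basis_fun d i x \<partial>PiM J (\<lambda>_. \<nu>)) = 0"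
  by (subst integral_PiM_fold[where p=i, OF measurable_basis_fun abs_basis_fun_le])
    (use assms in \<open>simp_all add: integral_basis_fun_upd\<close>)

lemma abs_mult_basis_fun_le: "\<bar>basis_fun d i x * basis_fun d' i' x\<bar> \<le> 9"
  unfolding abs_mult using mult_mono[OF abs_basis_fun_le[of d i x] abs_basis_fun_le[of d' i' x]] by simp

text \<open>The coordinate \<open>p\<close> occurs in one factor only; integrating it out first
  annihilates the product.\<close>

lemma orthogonal_basis_fun_support:
  assumes "finite J" "{i, i + d} \<subseteq> J" "{i', i' + d'} \<subseteq> J" and p: "p \<in> {i, i + d}" "p \<notin> {i', i' + d'}"
  shows "(\<integral>x. basis_fun d i x * basis_fun d' i' x \<partial>PiM J (\<lambda>_. \<nu>)) = 0"
proof -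
  have [measurable]: "basis_fun d i \<in> borel_measurable (PiM J (\<lambda>_. \<nu>))" "basis_fun d' i' \<in> borel_measurable (PiM J (\<lambda>_. \<nu>))"
    using assms by (auto intro!: measurable_basis_fun)
  have *: "basis_fun d' i' (x(p := \<xi>)) = basis_fun d' i' x" for x \<xi>
    using p by (auto simp: basis_fun_def)
  show ?thesis
    by (subst integral_PiM_fold[where p=p, OF _ abs_mult_basis_fun_le])
      (use assms in \<open>auto simp: * integral_basis_fun_upd\<close>)
qed

end

section \<open>Second moments of the sign kernel for a law without atoms\<close>

locale atomless_law = law +
  assumes atomless: "emeasure \<nu> {a} = 0"
begin

lemma AE_neq: "AE x in \<nu>. x \<noteq> a"
  by (rule AE_I[where N="{a}"]) (auto simp: atomless sets_law)

lemma integral_sgn_sq: "(\<integral>\<xi>. (sgn (\<xi> - a))\<^sup>2 \<partial>\<nu>) = 1"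
proof -
  have "(\<integral>\<xi>. (sgn (\<xi> - a))\<^sup>2 \<partial>\<nu>) = (\<integral>\<xi>. 1 \<partial>\<nu>)"
  proof (rule integral_cong_AE)
    show "AE \<xi> in \<nu>. (sgn (\<xi> - a))\<^sup>2 = 1"
      using AE_neq[of a] by eventually_elim (simp add: sgn_real_def)
  qed measurable
  then show ?thesis by simp
qed

text \<open>Integrating this symmetrised identity gives \<open>E h\<^sup>2 = 1/3\<close> without the distribution function.\<close>

lemma sgn_triple:
  fixes a b c :: real
  assumes "a \<noteq> b" "c \<noteq> a" "c \<noteq> b"
  shows "sgn (a - b) * sgn (a - c) + sgn (b - a) * sgn (b - c) + sgn (c - a) * sgn (c - b) = 1"
  using assms
  by (cases "a < b"; cases "a < c"; cases "b < c") (simp_all add: sgn_real_def)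

lemma integral_sgn_mean_sq: "(\<integral>a. (sgn_mean a)\<^sup>2 \<partial>\<nu>) = 1 / 3"
proof -
  let ?I = "\<integral>a. (sgn_mean a)\<^sup>2 \<partial>\<nu>"
  define J where "J a b = (\<integral>c. sgn (c - a) * sgn (c - b) \<partial>\<nu>)" for a b
  have J_meas [measurable]: "case_prod J \<in> borel_measurable (borel \<Otimes>\<^sub>M borel)"
  proof -
    have "(\<lambda>w. \<integral>c. sgn (c - fst w) * sgn (c - snd w) \<partial>\<nu>) \<in> borel_measurable (borel \<Otimes>\<^sub>M borel)"
      by measurable
    then show ?thesis by (simp add: J_def case_prod_beta')
  qed
  have ss: "\<bar>sgn a * sgn b\<bar> \<le> 1" for a b :: real by (intro abs_mult_le_one abs_sgn_le)
  have sm: "\<bar>sgn a * sgn_mean b\<bar> \<le> 1" for a b :: real by (intro abs_mult_le_one abs_sgn_le abs_sgn_mean_le)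
  have J_le: "\<bar>J a b\<bar> \<le> 1" for a b
  proof -
    have "\<bar>J a b\<bar> \<le> (\<integral>c. \<bar>sgn (c - a) * sgn (c - b)\<bar> \<partial>\<nu>)"
      unfolding J_def using integral_norm_bound[of \<nu> "\<lambda>c. sgn (c - a) * sgn (c - b)"] by simp
    also have "\<dots> \<le> (\<integral>\<xi>. 1 \<partial>\<nu>)"
      by (intro integral_mono integrable_bounded[where B=1]) (auto simp: ss)
    finally show ?thesis by simp
  qed
  \<comment> \<open>The triple identity is integrated over \<open>c\<close>, then \<open>b\<close>,
    then \<open>a\<close>; each of its three products finally contributes \<open>?I\<close>.\<close>
  have 1: "sgn (a - b) * sgn_mean a + sgn (b - a) * sgn_mean b + J a b = 1" if "a \<noteq> b" for a b
  proof -
    have i: "integrable \<nu> (\<lambda>c. sgn (a - b) * sgn (a - c))" "integrable \<nu> (\<lambda>c. sgn (b - a) * sgn (b - c))"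
      "integrable \<nu> (\<lambda>c. sgn (c - a) * sgn (c - b))"
      by (rule integrable_bounded[where B=1]; simp add: ss)+
    have "(\<integral>c. sgn (a - b) * sgn (a - c) + sgn (b - a) * sgn (b - c) + sgn (c - a) * sgn (c - b) \<partial>\<nu>) = (\<integral>c. 1 \<partial>\<nu>)"
    proof (rule integral_cong_AE)
      show "AE c in \<nu>. sgn (a - b) * sgn (a - c) + sgn (b - a) * sgn (b - c) + sgn (c - a) * sgn (c - b) = 1"
        using AE_neq[of a] AE_neq[of b] by eventually_elim (rule sgn_triple[OF that])
    qed measurable
    moreover have "(\<integral>c. sgn (a - b) * sgn (a - c) + sgn (b - a) * sgn (b - c) + sgn (c - a) * sgn (c - b) \<partial>\<nu>)
        = sgn (a - b) * sgn_mean a + sgn (b - a) * sgn_mean b + J a b"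
      unfolding sgn_mean_def J_def
        Bochner_Integration.integral_add[OF Bochner_Integration.integrable_add[OF i(1,2)] i(3)]
        Bochner_Integration.integral_add[OF i(1,2)] by simp
    ultimately show ?thesis by simp
  qed
  define S where "S a = (\<integral>b. sgn (b - a) * sgn_mean b \<partial>\<nu>)" for a
  define T where "T a = (\<integral>b. J a b \<partial>\<nu>)" for a
  \<comment> \<open>The excluded value \<open>b = a\<close> is a null set, so after this integration
    the identity holds at every \<open>a\<close>.\<close>
  have 2: "(sgn_mean a)\<^sup>2 + S a + T a = 1" for a
  proof -
    have i: "integrable \<nu> (\<lambda>b. sgn (a - b) * sgn_mean a)" "integrable \<nu> (\<lambda>b. sgn (b - a) * sgn_mean b)"
      "integrable \<nu> (\<lambda>b. J a b)"
      by (rule integrable_bounded[where B=1]; simp add: sm J_le)+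
    have "(\<integral>b. sgn (a - b) * sgn_mean a + sgn (b - a) * sgn_mean b + J a b \<partial>\<nu>) = (\<integral>c. 1 \<partial>\<nu>)"
    proof (rule integral_cong_AE)
      show "AE b in \<nu>. sgn (a - b) * sgn_mean a + sgn (b - a) * sgn_mean b + J a b = 1"
        using AE_neq[of a] by eventually_elim (rule 1, simp)
    qed measurable
    moreover have "(\<integral>b. sgn (a - b) * sgn_mean a + sgn (b - a) * sgn_mean b + J a b \<partial>\<nu>) = (sgn_mean a)\<^sup>2 + S a + T a"
      unfolding S_def T_def
        Bochner_Integration.integral_add[OF Bochner_Integration.integrable_add[OF i(1,2)] i(3)]
        Bochner_Integration.integral_add[OF i(1,2)]
      by (simp add: sgn_mean_def[symmetric] power2_eq_square)
    ultimately show ?thesis by simp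
  qed
  have S: "(\<integral>a. S a \<partial>\<nu>) = ?I"
  proof -
    have "(\<integral>a. S a \<partial>\<nu>) = (\<integral>b. (\<integral>a. sgn (b - a) * sgn_mean b \<partial>\<nu>) \<partial>\<nu>)"
      unfolding S_def by (rule integral_swap[where B=1]) (auto simp: sm)
    then show ?thesis by (simp add: sgn_mean_def[symmetric] power2_eq_square)
  qed
  \<comment> \<open>Doing the \<open>b\<close> integral first turns \<open>sgn (c - b)\<close> into
    \<open>sgn_mean c\<close>.\<close>
  have T: "T a = S a" for a
  proof -
    have "T a = (\<integral>c. (\<integral>b. sgn (c - a) * sgn (c - b) \<partial>\<nu>) \<partial>\<nu>)"
      unfolding T_def J_def by (rule integral_swap[where B=1]) (auto simp: ss)
    then show ?thesis by (simp add: S_def sgn_mean_def[symmetric])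
  qed
  note sqi = integrable_sgn_mean_sq
  \<comment> \<open>Eliminating \<open>T\<close> expresses \<open>S\<close> through the square of
    \<open>sgn_mean\<close>; integrating yields \<open>?I = (1 - ?I) / 2\<close>.\<close>
  have "S = (\<lambda>a. (1 - (sgn_mean a)\<^sup>2) / 2)" using 2 T by (simp add: fun_eq_iff field_simps)
  with S have "?I = (\<integral>a. (1 - (sgn_mean a)\<^sup>2) / 2 \<partial>\<nu>)" by metis
  also have "\<dots> = (1 - ?I) / 2" using sqi by simp
  finally show ?thesis by simp
qed

text \<open>Pythagoras predicts the value: the kernel has squared norm \<open>1\<close>, and its two
  one-variable parts take \<open>1/3\<close> each. The computation expands the square at fixed
  \<open>a\<close>; the mixed term \<open>S a\<close> is evaluated only after integration over
  \<open>a\<close>.\<close>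

lemma integral_sgn_inter_sq: "(\<integral>a. (\<integral>b. (sgn_inter a b)\<^sup>2 \<partial>\<nu>) \<partial>\<nu>) = 1 / 3"
proof -
  have si: "\<bar>sgn a * sgn_mean b\<bar> \<le> 1" for a b :: real by (intro abs_mult_le_one abs_sgn_le abs_sgn_mean_le)
  define S where "S a = (\<integral>b. sgn (b - a) * sgn_mean b \<partial>\<nu>)" for a
  note sqi = integrable_sgn_mean_sq
  have Sint: "integrable \<nu> S"
  proof -
    have "integrable \<nu> (\<lambda>a. \<integral>b. sgn (b - a) * sgn_mean b \<partial>\<nu>)"
    proof (rule PP.integrable_fst)
      show "integrable (\<nu> \<Otimes>\<^sub>M \<nu>) (\<lambda>(a, b). sgn (b - a) * sgn_mean b)"
        using si by (intro PP.integrable_const_bound[where B=1]) auto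
    qed
    then show ?thesis by (simp add: S_def[abs_def])
  qed
  have S: "(\<integral>a. S a \<partial>\<nu>) = 1 / 3"
  proof -
    have "(\<integral>a. S a \<partial>\<nu>) = (\<integral>b. (\<integral>a. sgn (b - a) * sgn_mean b \<partial>\<nu>) \<partial>\<nu>)"
      unfolding S_def by (rule integral_swap[where B=1]) (auto simp: si)
    then show ?thesis by (simp add: sgn_mean_def[symmetric] power2_eq_square integral_sgn_mean_sq[unfolded power2_eq_square])
  qed
  have "(\<integral>b. (sgn_inter a b)\<^sup>2 \<partial>\<nu>) = 4 / 3 - 2 * S a - (sgn_mean a)\<^sup>2" for a
  proof -
    have i: "integrable \<nu> (\<lambda>b. (sgn (b - a))\<^sup>2)" "integrable \<nu> (\<lambda>b. sgn (b - a) * sgn_mean b)"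
      unfolding power2_eq_square by (rule integrable_bounded[where B=1]; auto intro!: abs_mult_le_one abs_sgn_mean_le abs_sgn_le)+
    have "(sgn_inter a b)\<^sup>2 = (sgn (b - a))\<^sup>2 + (sgn_mean b)\<^sup>2 + (sgn_mean a)\<^sup>2 - 2 * (sgn (b - a) * sgn_mean b)
       + 2 * sgn_mean a * sgn (b - a) - 2 * sgn_mean a * sgn_mean b" for b
      unfolding sgn_inter_def by (simp add: power2_eq_square algebra_simps)
    then have "(\<integral>b. (sgn_inter a b)\<^sup>2 \<partial>\<nu>) = (\<integral>b. (sgn (b - a))\<^sup>2 + (sgn_mean b)\<^sup>2 + (sgn_mean a)\<^sup>2 - 2 * (sgn (b - a) * sgn_mean b)
       + 2 * sgn_mean a * sgn (b - a) - 2 * sgn_mean a * sgn_mean b \<partial>\<nu>)" by simp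
    also have "\<dots> = 1 + 1 / 3 + (sgn_mean a)\<^sup>2 - 2 * S a + 2 * sgn_mean a * (- sgn_mean a) - 2 * sgn_mean a * 0"
      using i sqi integrable_sgn integrable_sgn_mean
      by (simp add: S_def integral_sgn integral_sgn_mean integral_sgn_sq integral_sgn_mean_sq)
    finally show ?thesis by (simp add: power2_eq_square)
  qed
  then have "(\<integral>a. (\<integral>b. (sgn_inter a b)\<^sup>2 \<partial>\<nu>) \<partial>\<nu>) = (\<integral>a. 4 / 3 - 2 * S a - (sgn_mean a)\<^sup>2 \<partial>\<nu>)" by simp
  also have "\<dots> = 1 / 3"
    using Sint sqi by (simp add: S integral_sgn_mean_sq)
  finally show ?thesis .
qed

lemma integral_PiM_component:
  fixes f :: "real \<Rightarrow> real"
  assumes "i \<in> J" "f \<in> borel_measurable \<nu>"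
  shows "(\<integral>x. f (x i) \<partial>PiM J (\<lambda>_. \<nu>)) = (\<integral>a. f a \<partial>\<nu>)"
  by (subst (2) distr_PiM_component[of J "\<lambda>_. \<nu>" i, OF \<nu>.prob_space_axioms assms(1), symmetric],
      subst integral_distr) (use assms in auto)

lemma basis_fun_norm:
  assumes "finite J" "i \<in> J" "i + d \<in> J"
  shows "(\<integral>x. basis_fun d i x * basis_fun d i x \<partial>PiM J (\<lambda>_. \<nu>)) = 1 / 3"
proof (cases "d = 0")
  case True
  then show ?thesis
    using integral_PiM_component[OF assms(2), of "\<lambda>a. (sgn_mean a)\<^sup>2"] integral_sgn_mean_sq
    by (simp add: basis_fun_def power2_eq_square)
next
  case False
  have [measurable]: "basis_fun d i \<in> borel_measurable (PiM J (\<lambda>_. \<nu>))"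
    using assms by (auto intro!: measurable_basis_fun)
  have "(\<integral>x. basis_fun d i x * basis_fun d i x \<partial>PiM J (\<lambda>_. \<nu>))
      = (\<integral>x. (\<integral>b. (sgn_inter (x i) b)\<^sup>2 \<partial>\<nu>) \<partial>PiM (J - {i + d}) (\<lambda>_. \<nu>))"
  proof (subst integral_PiM_fold[where p="i + d", OF _ abs_mult_basis_fun_le])
    show "(\<integral>x. (\<integral>\<xi>. basis_fun d i (x(i + d := \<xi>)) * basis_fun d i (x(i + d := \<xi>)) \<partial>\<nu>) \<partial>PiM (J - {i + d}) (\<lambda>_. \<nu>))
      = (\<integral>x. (\<integral>b. (sgn_inter (x i) b)\<^sup>2 \<partial>\<nu>) \<partial>PiM (J - {i + d}) (\<lambda>_. \<nu>))"
      using False by (simp add: basis_fun_def power2_eq_square)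
  qed (use assms in simp_all)
  also have "\<dots> = (\<integral>a. (\<integral>b. (sgn_inter a b)\<^sup>2 \<partial>\<nu>) \<partial>\<nu>)"
  proof (rule integral_PiM_component)
    show "(\<lambda>a. \<integral>b. (sgn_inter a b)\<^sup>2 \<partial>\<nu>) \<in> borel_measurable \<nu>"
      unfolding sgn_inter_def by measurable
  qed (use assms False in simp)
  finally show ?thesis by (simp add: integral_sgn_inter_sq)
qed

text \<open>The index set \<open>{i, i + d}\<close> determines its minimum \<open>i\<close> and its
  spread \<open>d\<close>, so different labels leave some coordinate that occurs in one factor
  only.\<close>

lemma orthogonal_basis_fun:
  assumes J: "finite J" "{i, i + d} \<subseteq> J" "{i', i' + d'} \<subseteq> J"
  shows "(\<integral>x. basis_fun d i x * basis_fun d' i' x \<partial>PiM J (\<lambda>_. \<nu>)) = (if d = d' \<and> i = i' then 1 / 3 else 0)"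
proof (cases "d = d' \<and> i = i'")
  case True
  then show ?thesis using basis_fun_norm[of J i d] J by auto
next
  case False
  then have "(\<exists>p. p \<in> {i, i + d} \<and> p \<notin> {i', i' + d'}) \<or> (\<exists>p. p \<in> {i', i' + d'} \<and> p \<notin> {i, i + d})"
  proof -
    have "i \<notin> {i', i' + d'} \<or> i + d \<notin> {i', i' + d'} \<or> i' \<notin> {i, i + d} \<or> i' + d' \<notin> {i, i + d}"
      using False by simp presburger
    then show ?thesis by blast
  qed
  then have "(\<integral>x. basis_fun d i x * basis_fun d' i' x \<partial>PiM J (\<lambda>_. \<nu>)) = 0"
  proof (elim disjE exE conjE)
    fix p assume "p \<in> {i', i' + d'}" "p \<notin> {i, i + d}"
    from orthogonal_basis_fun_support[OF J(1,3,2) this] show ?thesis by (simp only: mult.commute)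
  qed (rule orthogonal_basis_fun_support[OF J])
  with False show ?thesis by auto
qed

end

subsection \<open>The eigenspace for the eigenvalue \<open>1\<close>\<close>

context law
begin

lemma funpow_H:
  assumes f: "f \<in> H_space \<nu> k"
  shows R_avg_funpow_H: "(R.avg k ^^ r) f \<in> H_space \<nu> k"
    and P_adj_funpow_H: "(P_adj \<nu> k ^^ r) f \<in> H_space \<nu> k"
  by (induction r) (simp_all add: f R_avg_H P_adj_H)

lemma inner_funpow:
  assumes f: "f \<in> H_space \<nu> k" and g: "g \<in> H_space \<nu> k"
  shows "L2_inner (prod_law \<nu> k) ((R.avg k ^^ r) f) g = L2_inner (prod_law \<nu> k) f ((P_adj \<nu> k ^^ r) g)"
  using g
proof (induction r arbitrary: g)
  case (Suc r)
  have "L2_inner (prod_law \<nu> k) ((R.avg k ^^ Suc r) f) g = L2_inner (prod_law \<nu> k) ((R.avg k ^^ r) f) (P_adj \<nu> k g)"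
    using P_adj_inner[OF R_avg_funpow_H[OF f] Suc.prems] by simp
  also have "\<dots> = L2_inner (prod_law \<nu> k) f ((P_adj \<nu> k ^^ r) (P_adj \<nu> k g))"
    by (rule Suc.IH[OF P_adj_H[OF Suc.prems]])
  finally show ?case by (simp add: funpow_swap1)
qed simp

text \<open>The value zero off the admissible range lets one formula describe all shifts: a term
  leaving at the right, or one whose truncated index \<open>i - r\<close> reaches \<open>0\<close>
  at the left, is the zero function.\<close>

definition chain :: "real \<Rightarrow> nat \<Rightarrow> nat \<Rightarrow> nat \<Rightarrow> (nat \<Rightarrow> real) \<Rightarrow> real" where
  "chain a k d i x = (if 1 \<le> i \<and> i + d \<le> k then a * basis_fun d i x else 0)"

lemma chain_H: "chain a k d i \<in> H_space \<nu> k"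
proof (cases "1 \<le> i \<and> i + d \<le> k")
  case True
  have eq: "chain a k d i = (\<lambda>x. a * basis_fun d i x)" using True by (auto simp: chain_def)
  have [measurable]: "basis_fun d i \<in> borel_measurable (prod_law \<nu> k)"
    unfolding prod_law_def by (rule measurable_basis_fun) (use True in auto)
  have "integrable (prod_law \<nu> k) (\<lambda>x. basis_fun d i x * basis_fun d i x)"
    unfolding prod_law_def
    by (rule integrable_PiM_bounded[OF _ abs_mult_basis_fun_le]) (unfold prod_law_def[symmetric], measurable)
  moreover have "(\<integral>x. basis_fun d i x \<partial>prod_law \<nu> k) = 0"
    unfolding prod_law_def by (rule integral_basis_fun) (use True in auto)
  ultimately show ?thesis
    by (simp add: H_space_def eq power_mult_distrib power2_eq_square[of "basis_fun d i x" for x])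
next
  case False
  then have "chain a k d i = (\<lambda>_. 0)" by (auto simp: chain_def)
  then show ?thesis by (simp add: H_space_def)
qed

lemma R_avg_chain:
  assumes "1 \<le> i"
  shows "R.avg k (chain a k d i) = chain a k d (Suc i)"
proof
  fix x
  consider "k < i + d" | "i + d = k" | "i + d < k" by linarith
  then show "R.avg k (chain a k d i) x = chain a k d (Suc i) x"
  proof cases
    \<comment> \<open>The last member of the chain: its final argument becomes the fresh variable,
      over which the mean is zero.\<close>
    case 2
    have "R.avg k (chain a k d i) x = (\<integral>\<xi>. a * basis_fun d i ((\<lambda>j. x (j + 1))(i + d := \<xi>)) \<partial>\<nu>)"
      unfolding R.avg_def
      by (rule Bochner_Integration.integral_cong[OF refl]) (use 2 assms in \<open>auto simp: chain_def right_shift_def basis_fun_def\<close>)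
    then show ?thesis using 2 by (simp add: integral_basis_fun_upd chain_def)
  next
    case 3
    have "R.avg k (chain a k d i) x = (\<integral>\<xi>. a * basis_fun d (Suc i) x \<partial>\<nu>)"
      unfolding R.avg_def
      by (rule Bochner_Integration.integral_cong[OF refl]) (use 3 assms in \<open>auto simp: chain_def right_shift_def basis_fun_def\<close>)
    then show ?thesis using 3 by (simp add: chain_def)
  qed (simp add: R.avg_def chain_def)
qed

lemma L_avg_chain:
  assumes "i + d \<le> k"
  shows "L.avg k (chain a k d i) = chain a k d (i - 1)"
proof
  fix x
  consider "i = 0" | "i = 1" | "1 < i" by linarith
  then show "L.avg k (chain a k d i) x = chain a k d (i - 1) x"
  proof cases
    case 2
    have "L.avg k (chain a k d i) x = (\<integral>\<xi>. a * basis_fun d i ((\<lambda>j. x (j - 1))(i := \<xi>)) \<partial>\<nu>)"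
      unfolding L.avg_def
      by (rule Bochner_Integration.integral_cong[OF refl]) (use 2 assms in \<open>auto simp: chain_def left_shift_def basis_fun_def\<close>)
    then show ?thesis using 2 by (simp add: integral_basis_fun_upd chain_def)
  next
    case 3
    have "L.avg k (chain a k d i) x = (\<integral>\<xi>. a * basis_fun d (i - 1) x \<partial>\<nu>)"
      unfolding L.avg_def
      by (rule Bochner_Integration.integral_cong[OF refl]) (use 3 assms in \<open>auto simp: chain_def left_shift_def basis_fun_def\<close>)
    then show ?thesis using 3 assms by (auto simp: chain_def)
  qed (simp add: L.avg_def chain_def)
qed

lemma R_avg_funpow_chain: "1 \<le> i \<Longrightarrow> (R.avg k ^^ r) (chain a k d i) = chain a k d (i + r)"
  by (induction r) (simp_all add: R_avg_chain)

lemma P_adj_funpow_chain: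
  assumes "i + d \<le> k"
  shows "AE x in prod_law \<nu> k. (P_adj \<nu> k ^^ r) (chain a k d i) x = chain a k d (i - r) x"
proof (induction r)
  case (Suc r)
  from P_adj_AE[OF P_adj_funpow_H[OF chain_H] chain_H Suc] assms show ?case
    by (simp add: L_avg_chain)
qed simp

text \<open>For eigenvalue \<open>1\<close> the nontrivial powers applied to \<open>f\<close> sum to
  zero almost everywhere. Pairing with a chain member and moving each power to the other factor
  turns powers of \<open>P\<close> into backward shifts of \<open>i\<close> and powers of the
  adjoint into forward ones.\<close>

lemma inner_L1_chain_aux:
  assumes f: "f \<in> L1_space \<nu> k" and i: "1 \<le> i" "i + d \<le> k"
  shows "(\<Sum>r=1..k-1. L2_inner (prod_law \<nu> k) f (chain a k d (i - r)) + L2_inner (prod_law \<nu> k) f (chain a k d (i + r))) = 0"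
proof -
  let ?N = "prod_law \<nu> k" and ?u = "chain a k d"
  have fH: "f \<in> H_space \<nu> k" and "AE x in ?N. B_op \<nu> k f x = f x"
    using f by (auto simp: L1_space_def)
  then have AE0: "AE x in ?N. (\<Sum>r=1..k-1. (R.avg k ^^ r) f x + (P_adj \<nu> k ^^ r) f x) = 0"
    by (simp add: B_op_def P_op_eq)
  have R: "L2_inner ?N ((R.avg k ^^ r) f) (?u i) = L2_inner ?N f (?u (i - r))" for r
    unfolding inner_funpow[OF fH chain_H]
    by (rule L2_inner_cong_AE[OF P_adj_funpow_chain[OF i(2)]]) (intro H_spaceD fH P_adj_funpow_H chain_H)+
  have S: "L2_inner ?N ((P_adj \<nu> k ^^ r) f) (?u i) = L2_inner ?N f (?u (i + r))" for r
    using inner_funpow[OF chain_H fH, of r a d i]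
    by (simp add: R_avg_funpow_chain[OF i(1)] L2_inner_commute)
  have "(\<Sum>r=1..k-1. L2_inner ?N f (?u (i - r)) + L2_inner ?N f (?u (i + r)))
      = (\<Sum>r=1..k-1. (\<integral>x. (R.avg k ^^ r) f x * ?u i x \<partial>?N) + (\<integral>x. (P_adj \<nu> k ^^ r) f x * ?u i x \<partial>?N))"
    unfolding R[symmetric] S[symmetric] by (simp only: L2_inner_def)
  also have "\<dots> = (\<Sum>r=1..k-1. (\<integral>x. (R.avg k ^^ r) f x * ?u i x + (P_adj \<nu> k ^^ r) f x * ?u i x \<partial>?N))"
    by (intro sum.cong refl Bochner_Integration.integral_add[symmetric] integrable_H R_avg_funpow_H P_adj_funpow_H fH chain_H)
  also have "\<dots> = (\<integral>x. (\<Sum>r=1..k-1. (R.avg k ^^ r) f x * ?u i x + (P_adj \<nu> k ^^ r) f x * ?u i x) \<partial>?N)"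
    by (intro Bochner_Integration.integral_sum[symmetric] Bochner_Integration.integrable_add integrable_H R_avg_funpow_H P_adj_funpow_H fH chain_H)
  also have "\<dots> = (\<integral>x. 0 \<partial>?N)"
  proof (rule integral_cong_AE)
    have m: "(R.avg k ^^ r) f \<in> borel_measurable ?N" "(P_adj \<nu> k ^^ r) f \<in> borel_measurable ?N"
      "?u i \<in> borel_measurable ?N" for r
      by (intro H_spaceD R_avg_funpow_H P_adj_funpow_H fH chain_H)+
    show "(\<lambda>x. \<Sum>r=1..k-1. (R.avg k ^^ r) f x * ?u i x + (P_adj \<nu> k ^^ r) f x * ?u i x) \<in> borel_measurable ?N"
      by (intro borel_measurable_sum borel_measurable_add borel_measurable_times m)
    show "AE x in ?N. (\<Sum>r=1..k-1. (R.avg k ^^ r) f x * ?u i x + (P_adj \<nu> k ^^ r) f x * ?u i x) = 0"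
      using AE0 by eventually_elim (simp add: distrib_right[symmetric] sum_distrib_right[symmetric])
  qed simp
  finally show ?thesis by simp
qed

text \<open>The operator \<open>B\<close> sends every member of a chain to the sum of the chain, so all inner products
  of an eigenfunction for the eigenvalue \<open>1\<close> with a chain of length \<open>m\<close> agree with \<open>m\<close> times
  their common value.\<close>

lemma inner_L1_chain:
  assumes f: "f \<in> L1_space \<nu> k" and d: "d + 1 < k"
  shows "L2_inner (prod_law \<nu> k) f (chain a k d i) = 0"
proof -
  define c where "c j = L2_inner (prod_law \<nu> k) f (chain a k d j)" for j
  define m where "m = k - d"
  have c0: "c j = 0" if "\<not> (1 \<le> j \<and> j + d \<le> k)" for j
  proof -
    have "chain a k d j x = 0" for x using that by (auto simp: chain_def)
    then show ?thesis by (simp add: c_def L2_inner_def)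
  qed
  have eq: "c i = (\<Sum>j=1..m. c j)" if i: "1 \<le> i" "i \<le> m" for i
  proof -
    \<comment> \<open>Lags leading outside \<open>1..m\<close> contribute zero by \<open>c0\<close>;
      the others visit every position of the chain except \<open>i\<close> exactly once.\<close>
    have "0 = (\<Sum>r=1..k-1. c (i - r)) + (\<Sum>r=1..k-1. c (i + r))"
      using inner_L1_chain_aux[OF f i(1), of d a] i d unfolding c_def[symmetric] m_def by (simp add: sum.distrib)
    also have "(\<Sum>r=1..k-1. c (i - r)) = (\<Sum>r=1..i-1. c (i - r))"
      by (rule sum.mono_neutral_right) (use i in \<open>auto simp: m_def intro!: c0\<close>)
    also have "\<dots> = (\<Sum>j=1..i-1. c j)"
      by (rule sum.reindex_bij_witness[of _ "\<lambda>j. i - j" "\<lambda>r. i - r"]) auto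
    also have "(\<Sum>r=1..k-1. c (i + r)) = (\<Sum>r=1..m-i. c (i + r))"
      by (rule sum.mono_neutral_right) (use i in \<open>auto simp: m_def intro!: c0\<close>)
    also have "\<dots> = (\<Sum>j=i+1..m. c j)"
      by (rule sum.reindex_bij_witness[of _ "\<lambda>j. j - i" "\<lambda>r. i + r"]) (use i in auto)
    also have "(\<Sum>j=1..i-1. c j) + (\<Sum>j=i+1..m. c j) = (\<Sum>j\<in>{1..m} - {i}. c j)"
      by (subst sum.union_disjoint[symmetric]) (use i in \<open>auto intro!: sum.cong\<close>)
    finally show ?thesis using i sum.remove[of "{1..m}" i c] by simp
  qed
  define T where "T = (\<Sum>j=1..m. c j)"
  have "T = (\<Sum>j=1..m. T)" unfolding T_def by (rule sum.cong[OF refl], rule eq) auto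
  then have "T = real m * T" by simp
  \<comment> \<open>Here \<open>d + 1 < k\<close> enters: for a chain of length one,
    \<open>T = m * T\<close> would be no constraint.\<close>
  moreover have "real m > 1" using d by (simp add: m_def)
  ultimately have "T = 0" by simp
  show ?thesis
  proof (cases "1 \<le> i \<and> i + d \<le> k")
    case True
    then have "1 \<le> i" "i \<le> m" by (auto simp: m_def)
    from eq[OF this] \<open>T = 0\<close> show ?thesis by (simp add: T_def c_def)
  next
    case False
    from c0[OF this] show ?thesis by (simp add: c_def)
  qed
qed

text \<open>At gap \<open>k - 1\<close> only position \<open>1\<close> is admissible, so every
  proper shift gives zero and \<open>B_op\<close> acts as the identity.\<close>

lemma chain_L1:
  assumes "1 \<le> k"
  shows "chain a k (k - 1) 1 \<in> L1_space \<nu> k"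
proof -
  let ?u = "chain a k (k - 1)"
  have "AE x in prod_law \<nu> k. \<forall>r\<in>{1..k-1}. (P_adj \<nu> k ^^ r) (?u 1) x = ?u (1 - r) x"
    by (intro AE_finite_allI P_adj_funpow_chain) (use assms in auto)
  then have "AE x in prod_law \<nu> k. B_op \<nu> k (?u 1) x = ?u 1 x"
  proof eventually_elim
    case (elim x)
    have "(\<Sum>r=1..k-1. (R.avg k ^^ r) (?u 1) x + (P_adj \<nu> k ^^ r) (?u 1) x) = 0"
    proof (rule sum.neutral, rule ballI)
      fix r assume r: "r \<in> {1..k-1}"
      then show "(R.avg k ^^ r) (?u 1) x + (P_adj \<nu> k ^^ r) (?u 1) x = 0"
        using elim assms by (auto simp: R_avg_funpow_chain chain_def)
    qed
    then show ?case by (simp add: B_op_def P_op_eq)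
  qed
  then show ?thesis using chain_H by (simp add: L1_space_def)
qed

text \<open>The witness \<open>g\<close> settles existence. Two candidates have equal inner products
  with all of \<open>S\<close>, hence with each other, and so equal norms: the choice made by
  \<open>SOME\<close> is immaterial.\<close>

lemma orth_proj_norm:
  assumes K: "K \<in> H_space \<nu> k" and S: "S \<subseteq> H_space \<nu> k" and g: "g \<in> S"
    and orth: "\<And>f. f \<in> S \<Longrightarrow> L2_inner (prod_law \<nu> k) (\<lambda>x. K x - g x) f = 0"
  shows "L2_inner (prod_law \<nu> k) (orth_proj (prod_law \<nu> k) S K) (orth_proj (prod_law \<nu> k) S K) = L2_inner (prod_law \<nu> k) g g"
proof -
  let ?N = "prod_law \<nu> k" and ?Q = "\<lambda>g. g \<in> S \<and> (\<forall>h\<in>S. L2_inner (prod_law \<nu> k) (\<lambda>x. K x - g x) h = 0)"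
  define p where "p = orth_proj ?N S K"
  have "?Q p" unfolding p_def orth_proj_def by (rule someI[of ?Q g]) (use g orth in auto)
  have diff: "L2_inner ?N (\<lambda>x. K x - b x) h = L2_inner ?N K h - L2_inner ?N b h" if "b \<in> S" "h \<in> S" for b h
    unfolding L2_inner_def left_diff_distrib
    by (rule Bochner_Integration.integral_diff) (rule integrable_H; use K S that in blast)+
  have "L2_inner ?N p h = L2_inner ?N g h" if "h \<in> S" for h
    using diff[OF g that] diff[of p h] \<open>?Q p\<close> orth that by simp
  from this[of p] this[of g] show ?thesis using \<open>?Q p\<close> g
    by (simp add: L2_inner_commute p_def[symmetric])
qed

section \<open>Expansion of the trend statistic in the orthogonal family\<close>

definition trend_coeff :: "(nat \<Rightarrow> real) \<Rightarrow> nat \<Rightarrow> nat \<Rightarrow> nat \<Rightarrow> real" where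
  "trend_coeff \<alpha> k d i =
    (if d = 0 then \<Sum>\<Delta>=1..k-1. \<alpha> \<Delta> * (of_bool (\<Delta> < i) - of_bool (i \<le> k - \<Delta>)) else \<alpha> d)"

text \<open>Index \<open>i\<close> is the later member of a pair at lag \<Delta> iff
  \<open>\<Delta> < i\<close>, and the earlier one iff \<open>i \<le> k - \<Delta>\<close>. This
  explains the signs in \<open>trend_coeff\<close> at gap \<open>0\<close>.\<close>

lemma sum_shift_diff:
  fixes g :: "nat \<Rightarrow> real"
  shows "(\<Sum>i=1..k. (of_bool (\<Delta> < i) - of_bool (i \<le> k - \<Delta>)) * g i) = (\<Sum>j=1..k-\<Delta>. g (\<Delta> + j) - g j)"
proof -
  have "(\<Sum>i=1..k. of_bool (\<Delta> < i) * g i) = (\<Sum>i=\<Delta>+1..k. g i)"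
    by (rule sum.mono_neutral_cong_right) auto
  also have "\<dots> = (\<Sum>j=1..k-\<Delta>. g (\<Delta> + j))"
    by (rule sum.reindex_bij_witness[of _ "\<lambda>j. \<Delta> + j" "\<lambda>i. i - \<Delta>"]) auto
  finally have 1: "(\<Sum>i=1..k. of_bool (\<Delta> < i) * g i) = (\<Sum>j=1..k-\<Delta>. g (\<Delta> + j))" .
  have 2: "(\<Sum>i=1..k. of_bool (i \<le> k - \<Delta>) * g i) = (\<Sum>j=1..k-\<Delta>. g j)"
    by (rule sum.mono_neutral_cong_right) auto
  show ?thesis unfolding left_diff_distrib sum_subtractf 1 2 ..
qed

text \<open>One-variable terms enter as differences, so the constant \<open>g = 1\<close> in
  \<open>sum_shift_diff\<close> gives zero. This will remove gap \<open>0\<close> from the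
  asymptotic variance.\<close>

lemma sum_trend_coeff_0: "(\<Sum>i=1..k. trend_coeff \<alpha> k 0 i) = 0"
proof -
  have "(\<Sum>i=1..k. trend_coeff \<alpha> k 0 i)
      = (\<Sum>\<Delta>=1..k-1. \<alpha> \<Delta> * (\<Sum>i=1..k. (of_bool (\<Delta> < i) - of_bool (i \<le> k - \<Delta>)) * 1))"
    unfolding trend_coeff_def sum_distrib_left by (subst sum.swap) simp
  then show ?thesis unfolding sum_shift_diff by simp
qed

lemma trend_stat_eq:
  assumes "1 \<le> k"
  shows "trend_stat \<alpha> k x = (\<Sum>d<k. \<Sum>i=1..k-d. trend_coeff \<alpha> k d i * basis_fun d i x)"
proof -
  let ?h = "\<lambda>i. sgn_mean (x i)"
  have "trend_stat \<alpha> k x = (\<Sum>\<Delta>=1..k-1. \<Sum>j=1..k-\<Delta>. \<alpha> \<Delta> * basis_fun \<Delta> j x + \<alpha> \<Delta> * (?h (\<Delta> + j) - ?h j))"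
    unfolding trend_stat_def
    by (intro sum.cong refl) (auto simp: basis_fun_def sgn_inter_def algebra_simps)
  also have "\<dots> = (\<Sum>\<Delta>=1..k-1. \<alpha> \<Delta> * (\<Sum>j=1..k-\<Delta>. ?h (\<Delta> + j) - ?h j))
     + (\<Sum>\<Delta>=1..k-1. \<Sum>j=1..k-\<Delta>. \<alpha> \<Delta> * basis_fun \<Delta> j x)"
    by (simp add: sum.distrib sum_distrib_left)
  also have "(\<Sum>\<Delta>=1..k-1. \<alpha> \<Delta> * (\<Sum>j=1..k-\<Delta>. ?h (\<Delta> + j) - ?h j)) = (\<Sum>i=1..k. trend_coeff \<alpha> k 0 i * basis_fun 0 i x)"
  proof -
    have "(\<Sum>i=1..k. trend_coeff \<alpha> k 0 i * basis_fun 0 i x)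
        = (\<Sum>i=1..k. \<Sum>\<Delta>=1..k-1. \<alpha> \<Delta> * ((of_bool (\<Delta> < i) - of_bool (i \<le> k - \<Delta>)) * ?h i))"
      by (simp add: trend_coeff_def basis_fun_def sum_distrib_right mult.assoc)
    also have "\<dots> = (\<Sum>\<Delta>=1..k-1. \<Sum>i=1..k. \<alpha> \<Delta> * ((of_bool (\<Delta> < i) - of_bool (i \<le> k - \<Delta>)) * ?h i))"
      by (rule sum.swap)
    finally show ?thesis by (simp only: sum_distrib_left[symmetric] sum_shift_diff)
  qed
  also have "(\<Sum>\<Delta>=1..k-1. \<Sum>j=1..k-\<Delta>. \<alpha> \<Delta> * basis_fun \<Delta> j x) = (\<Sum>d=1..k-1. \<Sum>i=1..k-d. trend_coeff \<alpha> k d i * basis_fun d i x)"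
    by (intro sum.cong refl) (auto simp: trend_coeff_def)
  also have "(\<Sum>i=1..k. trend_coeff \<alpha> k 0 i * basis_fun 0 i x) + \<dots>
      = (\<Sum>d\<in>insert 0 {1..k-1}. \<Sum>i=1..k-d. trend_coeff \<alpha> k d i * basis_fun d i x)"
    by simp
  also have "insert 0 {1..k-1} = {..<k}" using assms by auto
  finally show ?thesis .
qed

lemma trend_stat_eq_chain:
  assumes "1 \<le> k"
  shows "trend_stat \<alpha> k x = (\<Sum>d<k. \<Sum>i=1..k-d. chain (trend_coeff \<alpha> k d i) k d i x)"
  unfolding trend_stat_eq[OF assms] by (intro sum.cong refl) (auto simp: chain_def)

lemma sum_H:
  assumes "\<And>i. i \<in> A \<Longrightarrow> f i \<in> H_space \<nu> k"
  shows "(\<lambda>x. \<Sum>i\<in>A. f i x) \<in> H_space \<nu> k"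
  using assms
proof (induction A rule: infinite_finite_induct)
  case (insert j A)
  \<comment> \<open>Addition is written as a double difference to reduce it to
    \<open>diff_H\<close>.\<close>
  have "(\<lambda>x. f j x - (0 - (\<Sum>i\<in>A. f i x))) \<in> H_space \<nu> k"
    by (intro diff_H insert) (use insert in \<open>simp_all add: H_space_def\<close>)
  then show ?case using insert by simp
qed (simp_all add: H_space_def)

end

text \<open>Terms of gap below \<open>k - 1\<close> belong to chains of length at least two and are
  orthogonal to the eigenspace, whereas the single term of gap \<open>k - 1\<close> lies in it; that
  term is therefore the projection.\<close>

lemma (in atomless_law) norm_incr_component_trend_stat:
  assumes k: "2 \<le> k"
  shows "(L2_norm (prod_law \<nu> k) (incr_component \<nu> k (trend_stat \<alpha> k)))\<^sup>2 = (\<alpha> (k - 1))\<^sup>2 / 3"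
proof -
  let ?N = "prod_law \<nu> k" and ?c = "trend_coeff \<alpha> k"
  define g where "g = chain (\<alpha> (k - 1)) k (k - 1) 1"
  have k1: "1 \<le> k" using k by simp
  have K: "trend_stat \<alpha> k \<in> H_space \<nu> k"
    unfolding trend_stat_eq_chain[OF k1, abs_def] by (intro sum_H chain_H)
  \<comment> \<open>The top gap is split off. Since \<open>k\<close> is at least \<open>2\<close> it
    is not gap \<open>0\<close>, so its coefficient is \<open>\<alpha> (k - 1)\<close>.\<close>
  have "{..<k} = insert (k - 1) {..<k-1}" using k by auto
  then have diff: "trend_stat \<alpha> k x - g x = (\<Sum>d<k-1. \<Sum>i=1..k-d. chain (?c d i) k d i x)" for x
    unfolding trend_stat_eq_chain[OF k1] g_def using k by (simp add: trend_coeff_def)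
  have orth: "L2_inner ?N (\<lambda>x. trend_stat \<alpha> k x - g x) f = 0" if f: "f \<in> L1_space \<nu> k" for f
  proof -
    have fH: "f \<in> H_space \<nu> k" using f by (simp add: L1_space_def)
    have "L2_inner ?N (\<lambda>x. trend_stat \<alpha> k x - g x) f = (\<Sum>d<k-1. \<Sum>i=1..k-d. L2_inner ?N (chain (?c d i) k d i) f)"
      unfolding diff L2_inner_def sum_distrib_right
      by (simp add: Bochner_Integration.integral_sum Bochner_Integration.integrable_sum integrable_H chain_H fH)
    also have "\<dots> = 0"
      by (intro sum.neutral ballI, subst L2_inner_commute, rule inner_L1_chain[OF f]) auto
    finally show ?thesis .
  qed
  have "L2_inner ?N g g = (\<integral>x. (\<alpha> (k - 1))\<^sup>2 * (basis_fun (k - 1) 1 x * basis_fun (k - 1) 1 x) \<partial>?N)"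
    unfolding L2_inner_def g_def using k by (simp add: chain_def power2_eq_square ac_simps)
  also have "\<dots> = (\<alpha> (k - 1))\<^sup>2 * (1 / 3)"
    unfolding prod_law_def using k by (subst integral_mult_right_zero, subst basis_fun_norm) auto
  finally have gg: "L2_inner ?N g g = (\<alpha> (k - 1))\<^sup>2 / 3" by simp
  have inc: "L2_inner ?N (incr_component \<nu> k (trend_stat \<alpha> k)) (incr_component \<nu> k (trend_stat \<alpha> k)) = L2_inner ?N g g"
    unfolding incr_component_def
  proof (rule orth_proj_norm[OF K _ _ orth])
    show "L1_space \<nu> k \<subseteq> H_space \<nu> k" by (auto simp: L1_space_def)
    show "g \<in> L1_space \<nu> k" unfolding g_def by (rule chain_L1[OF k1])
  qed
  show ?thesis unfolding L2_norm_def inc gg by simp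
qed

subsection \<open>Asymptotic variance\<close>

text \<open>The square of a sum with its off-diagonal products grouped by lag. Lags beyond
  \<open>m - 1\<close> contribute zero, so one range up to \<open>k - 1\<close> serves the chains of
  all gaps.\<close>

lemma sum_sq_lags:
  fixes a :: "nat \<Rightarrow> real"
  assumes "m \<le> k"
  shows "(\<Sum>i=1..m. (a i)\<^sup>2) + 2 * (\<Sum>r=1..k-1. \<Sum>i=1..m. if i + r \<le> m then a i * a (i + r) else 0) = (\<Sum>i=1..m. a i)\<^sup>2"
  using assms
proof (induction m)
  case (Suc m)
  have split: "(if i + r \<le> Suc m then a i * a (i + r) else 0)
      = (if i + r \<le> m then a i * a (i + r) else 0) + (if r = Suc m - i then a i * a (Suc m) else 0)"
    if "1 \<le> i" "i \<le> m" for i r using that by auto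
  have "(\<Sum>r=1..k-1. \<Sum>i=1..Suc m. if i + r \<le> Suc m then a i * a (i + r) else 0)
     = (\<Sum>r=1..k-1. \<Sum>i=1..m. if i + r \<le> Suc m then a i * a (i + r) else 0)"
    by (rule sum.cong[OF refl]) simp
  also have "\<dots> = (\<Sum>r=1..k-1. \<Sum>i=1..m. (if i + r \<le> m then a i * a (i + r) else 0) + (if r = Suc m - i then a i * a (Suc m) else 0))"
    by (intro sum.cong refl split) auto
  also have "\<dots> = (\<Sum>r=1..k-1. \<Sum>i=1..m. if i + r \<le> m then a i * a (i + r) else 0)
     + (\<Sum>r=1..k-1. \<Sum>i=1..m. if r = Suc m - i then a i * a (Suc m) else 0)"
    by (simp only: sum.distrib)
  \<comment> \<open>Each \<open>i\<close> meets the new entry at the single lag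
    \<open>Suc m - i\<close>, which lies in \<open>1..k-1\<close> because
    \<open>Suc m \<le> k\<close>.\<close>
  also have "(\<Sum>r=1..k-1. \<Sum>i=1..m. if r = Suc m - i then a i * a (Suc m) else 0) = (\<Sum>i=1..m. a i * a (Suc m))"
    by (subst sum.swap, intro sum.cong refl) (use Suc.prems in \<open>auto simp: sum.delta\<close>)
  finally have "(\<Sum>r=1..k-1. \<Sum>i=1..Suc m. if i + r \<le> Suc m then a i * a (i + r) else 0)
     = (\<Sum>r=1..k-1. \<Sum>i=1..m. if i + r \<le> m then a i * a (i + r) else 0) + (\<Sum>i=1..m. a i) * a (Suc m)"
    by (simp only: sum_distrib_right)
  then show ?case using Suc by (simp add: power2_eq_square algebra_simps)
qed simp

context atomless_law
begin

definition pairs :: "nat \<Rightarrow> (nat \<times> nat) set" where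
  "pairs k = Sigma {..<k} (\<lambda>d. {1..k-d})"

lemma finite_pairs [simp]: "finite (pairs k)"
  by (simp add: pairs_def)

lemma sum_pairs: "(\<Sum>p\<in>pairs k. f (fst p) (snd p)) = (\<Sum>d<k. \<Sum>i=1..k-d. f d i)"
  unfolding pairs_def by (subst sum.Sigma) (auto simp: case_prod_beta')

text \<open>The statistic of the block starting at \<open>1 + r\<close>, expressed in one common
  vector of length \<open>2 * k\<close>, which contains all blocks with
  \<open>r < k\<close>.\<close>

definition shifted :: "(nat \<Rightarrow> real) \<Rightarrow> nat \<Rightarrow> nat \<Rightarrow> (nat \<Rightarrow> real) \<Rightarrow> real" where
  "shifted \<alpha> k r z = (\<Sum>p\<in>pairs k. trend_coeff \<alpha> k (fst p) (snd p) * basis_fun (fst p) (snd p + r) z)"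

lemma shifted_eq:
  "shifted \<alpha> k r z = (\<Sum>d<k. \<Sum>i=1..k-d. trend_coeff \<alpha> k d i * basis_fun d (i + r) z)"
  unfolding shifted_def by (rule sum_pairs[of "\<lambda>d i. trend_coeff \<alpha> k d i * basis_fun d (i + r) z"])

lemma pairs_subset: "p \<in> pairs k \<Longrightarrow> r < k \<Longrightarrow> {snd p + r, snd p + r + fst p} \<subseteq> {1..2*k}"
  by (auto simp: pairs_def)

lemma measurable_shifted:
  assumes "r < k"
  shows "shifted \<alpha> k r \<in> borel_measurable (prod_law \<nu> (2 * k))"
  unfolding shifted_def[abs_def] prod_law_def
  using pairs_subset[OF _ assms]
  by (intro borel_measurable_sum borel_measurable_times borel_measurable_const measurable_basis_fun) blast+

lemma integrable_basis_fun_mult: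
  assumes "{i, i + d} \<subseteq> J" "{i', i' + d'} \<subseteq> J"
  shows "integrable (PiM J (\<lambda>_. \<nu>)) (\<lambda>x. basis_fun d i x * basis_fun d' i' x)"
  by (rule integrable_PiM_bounded[OF borel_measurable_times abs_mult_basis_fun_le])
    (use assms in \<open>auto intro: measurable_basis_fun\<close>)

lemma integral_shifted:
  assumes "r < k"
  shows "(\<integral>z. shifted \<alpha> k r z \<partial>prod_law \<nu> (2 * k)) = 0"
proof -
  let ?N = "PiM {1..2*k} (\<lambda>_. \<nu>)"
  have "integrable ?N (\<lambda>z. basis_fun (fst p) (snd p + r) z)" "(\<integral>z. basis_fun (fst p) (snd p + r) z \<partial>?N) = 0"
    if "p \<in> pairs k" for p
    using pairs_subset[OF that assms]
    by (auto intro!: integrable_PiM_bounded[OF measurable_basis_fun abs_basis_fun_le] integral_basis_fun)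
  then show ?thesis unfolding shifted_def prod_law_def
    by (subst Bochner_Integration.integral_sum) auto
qed

text \<open>By orthogonality a term of the shifted factor at position \<open>i\<close> meets only
  the term of the same gap at position \<open>i + r\<close> in the unshifted one; the condition in
  the sum says that this position still fits in the block.\<close>

lemma integral_shifted_mult:
  assumes "r < k"
  shows "(\<integral>z. shifted \<alpha> k 0 z * shifted \<alpha> k r z \<partial>prod_law \<nu> (2 * k))
    = (\<Sum>d<k. \<Sum>i=1..k-d. if i + r \<le> k - d then trend_coeff \<alpha> k d i * trend_coeff \<alpha> k d (i + r) else 0) / 3"
proof -
  let ?N = "PiM {1..2*k} (\<lambda>_. \<nu>)" and ?c = "\<lambda>p. trend_coeff \<alpha> k (fst p) (snd p)"
  let ?b = "\<lambda>r p. basis_fun (fst p) (snd p + r)"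
  have int: "integrable ?N (\<lambda>z. ?c p * ?c q * (?b 0 p z * ?b r q z))" if "p \<in> pairs k" "q \<in> pairs k" for p q
    by (intro integrable_mult_right integrable_basis_fun_mult pairs_subset that) (use assms in auto)
  have "(\<integral>z. shifted \<alpha> k 0 z * shifted \<alpha> k r z \<partial>?N)
      = (\<integral>z. (\<Sum>p\<in>pairs k. \<Sum>q\<in>pairs k. ?c p * ?c q * (?b 0 p z * ?b r q z)) \<partial>?N)"
    unfolding shifted_def sum_product by (simp only: ac_simps)
  also have "\<dots> = (\<Sum>p\<in>pairs k. (\<integral>z. (\<Sum>q\<in>pairs k. ?c p * ?c q * (?b 0 p z * ?b r q z)) \<partial>?N))"
    by (intro Bochner_Integration.integral_sum Bochner_Integration.integrable_sum int)
  also have "\<dots> = (\<Sum>p\<in>pairs k. \<Sum>q\<in>pairs k. (\<integral>z. ?c p * ?c q * (?b 0 p z * ?b r q z) \<partial>?N))"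
    by (intro sum.cong refl Bochner_Integration.integral_sum int)
  also have "\<dots> = (\<Sum>p\<in>pairs k. \<Sum>q\<in>pairs k. if p = (fst q, snd q + r) then ?c p * ?c q / 3 else 0)"
  proof (intro sum.cong refl)
    fix p q assume "p \<in> pairs k" "q \<in> pairs k"
    then have "(\<integral>z. ?b 0 p z * ?b r q z \<partial>?N) = (if fst p = fst q \<and> snd p + 0 = snd q + r then 1 / 3 else 0)"
      using assms by (intro orthogonal_basis_fun pairs_subset) auto
    then show "(\<integral>z. ?c p * ?c q * (?b 0 p z * ?b r q z) \<partial>?N) = (if p = (fst q, snd q + r) then ?c p * ?c q / 3 else 0)"
      by (simp add: prod_eq_iff)
  qed
  also have "\<dots> = (\<Sum>q\<in>pairs k. \<Sum>p\<in>pairs k. if p = (fst q, snd q + r) then ?c p * ?c q / 3 else 0)"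
    by (rule sum.swap)
  also have "\<dots> = (\<Sum>q\<in>pairs k. if (fst q, snd q + r) \<in> pairs k then ?c (fst q, snd q + r) * ?c q / 3 else 0)"
    by (simp add: sum.delta)
  also have "\<dots> = (\<Sum>q\<in>pairs k. (if snd q + r \<le> k - fst q then ?c q * ?c (fst q, snd q + r) else 0) / 3)"
    by (rule sum.cong) (auto simp: pairs_def)
  also have "\<dots> = (\<Sum>q\<in>pairs k. if snd q + r \<le> k - fst q then ?c q * ?c (fst q, snd q + r) else 0) / 3"
    by (rule sum_divide_distrib[symmetric])
  also have "(\<Sum>q\<in>pairs k. if snd q + r \<le> k - fst q then ?c q * ?c (fst q, snd q + r) else 0)
     = (\<Sum>d<k. \<Sum>i=1..k-d. if i + r \<le> k - d then trend_coeff \<alpha> k d i * trend_coeff \<alpha> k d (i + r) else 0)"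
    unfolding fst_conv snd_conv by (rule sum_pairs)
  finally show ?thesis by (simp add: prod_law_def)
qed

lemma asymp_var_trend_stat:
  fixes M :: "'a measure" and X :: "nat \<Rightarrow> 'a \<Rightarrow> real"
  assumes k: "2 \<le> k" and M: "prob_space M" and indep: "prob_space.indep_vars M (\<lambda>_. borel) X {1..}"
    and dist: "\<And>i. i \<ge> 1 \<Longrightarrow> distr M borel (X i) = \<nu>"
  shows "asymp_var M X k (trend_stat \<alpha> k) = (\<Sum>\<Delta>=1..k-1. (real (k - \<Delta>))\<^sup>2 * (\<alpha> \<Delta>)\<^sup>2) / 3"
proof -
  interpret M: prob_space M by (rule M)
  let ?J = "{1..2*k}" and ?N = "prod_law \<nu> (2 * k)" and ?c = "trend_coeff \<alpha> k"
  \<comment> \<open>All blocks involved are read off this one vector, whose law is the product law;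
    every mean and covariance becomes an integral of \<open>shifted\<close> functions.\<close>
  define Z where "Z \<omega> = (\<lambda>i\<in>?J. X i \<omega>)" for \<omega>
  have X: "X i \<in> borel_measurable M" if "1 \<le> i" for i
    using indep that by (auto simp: M.indep_vars_def)
  have iJ: "M.indep_vars (\<lambda>_. borel) X ?J"
    by (rule M.indep_vars_subset[OF indep]) auto
  have "distr M (PiM ?J (\<lambda>_. borel)) Z = PiM ?J (\<lambda>i. distr M borel (X i))"
    unfolding Z_def using iJ k X by (subst (asm) M.indep_vars_iff_distr_eq_PiM') auto
  also have "\<dots> = ?N" unfolding prod_law_def by (rule PiM_cong) (auto simp: dist)
  finally have distZ: "distr M (PiM ?J (\<lambda>_. borel)) Z = ?N" .
  have Zm: "Z \<in> measurable M (PiM ?J (\<lambda>_. borel))" unfolding Z_def by (intro measurable_restrict X) auto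
  have sets: "sets (PiM ?J (\<lambda>_. borel)) = sets ?N" unfolding prod_law_def by (rule sets_PiM_cong) (auto simp: sets_law)
  have E: "M.expectation (\<lambda>\<omega>. G (Z \<omega>)) = (\<integral>z. G z \<partial>?N)" if "G \<in> borel_measurable ?N" for G :: "(nat \<Rightarrow> real) \<Rightarrow> real"
    unfolding distZ[symmetric]
    by (rule integral_distr[OF Zm, symmetric]) (use that measurable_cong_sets[OF sets refl] in auto)
  have blk: "trend_stat \<alpha> k (block k X (1 + r) \<omega>) = shifted \<alpha> k r (Z \<omega>)" if "r < k" for r \<omega>
  proof -
    have "basis_fun d i (block k X (1 + r) \<omega>) = basis_fun d (i + r) (Z \<omega>)" if "d < k" "i \<in> {1..k-d}" for d i
      using that \<open>r < k\<close> by (auto simp: basis_fun_def block_def Z_def ac_simps)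
    moreover have "1 \<le> k" using k by simp
    ultimately show ?thesis by (simp add: trend_stat_eq shifted_eq)
  qed
  have mean: "M.expectation (\<lambda>\<omega>. trend_stat \<alpha> k (block k X (1 + r) \<omega>)) = 0" if "r < k" for r
    unfolding blk[OF that] using E[OF measurable_shifted[OF that]] integral_shifted[OF that] by simp
  have k0: "0 < k" using k by simp
  define s where "s r = (\<Sum>d<k. \<Sum>i=1..k-d. if i + r \<le> k - d then ?c d i * ?c d (i + r) else 0)" for r
  have cov: "covar M (\<lambda>\<omega>. trend_stat \<alpha> k (block k X 1 \<omega>)) (\<lambda>\<omega>. trend_stat \<alpha> k (block k X (1 + r) \<omega>)) = s r / 3" if r: "r < k" for r
  proof -
    have "covar M (\<lambda>\<omega>. trend_stat \<alpha> k (block k X 1 \<omega>)) (\<lambda>\<omega>. trend_stat \<alpha> k (block k X (1 + r) \<omega>))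
        = M.expectation (\<lambda>\<omega>. shifted \<alpha> k 0 (Z \<omega>) * shifted \<alpha> k r (Z \<omega>))"
      unfolding covar_def mean[OF r] using mean[OF k0] blk[OF k0] blk[OF r] by simp
    also have "\<dots> = (\<integral>z. shifted \<alpha> k 0 z * shifted \<alpha> k r z \<partial>?N)"
      by (rule E) (intro borel_measurable_times measurable_shifted r k0)
    finally show ?thesis unfolding integral_shifted_mult[OF r] s_def .
  qed
  have "asymp_var M X k (trend_stat \<alpha> k) = s 0 / 3 + 2 * (\<Sum>r=1..k-1. s r / 3)"
  proof -
    have "M.variance (\<lambda>\<omega>. trend_stat \<alpha> k (block k X 1 \<omega>)) = s 0 / 3"
      using cov[OF k0] by (simp add: covar_def power2_eq_square)
    moreover have "(\<Sum>r=1..k-1. covar M (\<lambda>\<omega>. trend_stat \<alpha> k (block k X 1 \<omega>)) (\<lambda>\<omega>. trend_stat \<alpha> k (block k X (1 + r) \<omega>)))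
      = (\<Sum>r=1..k-1. s r / 3)"
      by (intro sum.cong refl cov) (use k in auto)
    ultimately show ?thesis by (simp add: asymp_var_def)
  qed
  also have "\<dots> = (s 0 + 2 * (\<Sum>r=1..k-1. s r)) / 3" by (simp add: sum_divide_distrib[symmetric] add_divide_distrib)
  also have "s 0 + 2 * (\<Sum>r=1..k-1. s r) = (\<Sum>d<k. (\<Sum>i=1..k-d. (?c d i)\<^sup>2) +
      2 * (\<Sum>r=1..k-1. \<Sum>i=1..k-d. if i + r \<le> k - d then ?c d i * ?c d (i + r) else 0))"
  proof -
    have "s 0 = (\<Sum>d<k. \<Sum>i=1..k-d. (?c d i)\<^sup>2)" unfolding s_def by (intro sum.cong refl) (auto simp: power2_eq_square)
    moreover have "(\<Sum>r=1..k-1. s r) = (\<Sum>d<k. \<Sum>r=1..k-1. \<Sum>i=1..k-d. if i + r \<le> k - d then ?c d i * ?c d (i + r) else 0)"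
      unfolding s_def by (rule sum.swap)
    ultimately show ?thesis by (simp only: sum.distrib sum_distrib_left)
  qed
  \<comment> \<open>Variance and lagged covariances recombine, gap by gap, into the square of a
    coefficient sum. Gap \<open>0\<close> then drops out, and the constant coefficients of gap
    \<open>d\<close> sum to \<open>(k - d) * \<alpha> d\<close>.\<close>
  also have "\<dots> = (\<Sum>d<k. (\<Sum>i=1..k-d. ?c d i)\<^sup>2)"
    by (intro sum.cong refl sum_sq_lags) auto
  also have "{..<k} = insert 0 {1..k-1}" using k by auto
  also have "(\<Sum>d\<in>insert 0 {1..k-1}. (\<Sum>i=1..k-d. ?c d i)\<^sup>2) = (\<Sum>d=1..k-1. (\<Sum>i=1..k-d. ?c d i)\<^sup>2)"
    using sum_trend_coeff_0[of \<alpha> k] by simp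
  also have "\<dots> = (\<Sum>\<Delta>=1..k-1. (real (k - \<Delta>))\<^sup>2 * (\<alpha> \<Delta>)\<^sup>2)"
    by (intro sum.cong refl) (simp add: trend_coeff_def power_mult_distrib)
  finally show ?thesis .
qed

lemma incr_index_trend_stat:
  fixes M :: "'a measure" and X :: "nat \<Rightarrow> 'a \<Rightarrow> real"
  assumes k: "2 \<le> k" and M: "prob_space M" and indep: "prob_space.indep_vars M (\<lambda>_. borel) X {1..}"
    and dist: "\<And>i. i \<ge> 1 \<Longrightarrow> distr M borel (X i) = \<nu>"
  shows "incr_index \<nu> M X k (trend_stat \<alpha> k) = (\<alpha> (k - 1))\<^sup>2 / (\<Sum>\<Delta>=1..k-1. (real (k - \<Delta>))\<^sup>2 * (\<alpha> \<Delta>)\<^sup>2)"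
proof -
  have "asymp_var M X k (trend_stat \<alpha> k) = (\<Sum>\<Delta>=1..k-1. (real (k - \<Delta>))\<^sup>2 * (\<alpha> \<Delta>)\<^sup>2) / 3"
    by (rule asymp_var_trend_stat[OF k M indep]) (rule dist)
  then show ?thesis unfolding incr_index_def norm_incr_component_trend_stat[OF k] by simp
qed

end

subsection \<open>Growth of the index for power weights\<close>

text \<open>The reciprocal of the index at \<open>m = k - 1\<close> and \<open>q = 2 * p\<close>,
  after the reversal \<open>j = k - \<Delta>\<close> and division by the numerator. In this form
  monotonicity can be checked term by term.\<close>

definition power_index_inv :: "real \<Rightarrow> nat \<Rightarrow> real" where
  "power_index_inv q m = (\<Sum>j=1..m. (real j)\<^sup>2 * ((real m + 1 - real j) / real m) powr q)"

lemma power_index_eq: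
  assumes "2 \<le> k"
  shows "real (k - 1) powr q / (\<Sum>\<Delta>=1..k-1. (real (k - \<Delta>))\<^sup>2 * real \<Delta> powr q) = 1 / power_index_inv q (k - 1)"
proof -
  have "(\<Sum>\<Delta>=1..k-1. (real (k - \<Delta>))\<^sup>2 * real \<Delta> powr q)
      = (\<Sum>j=1..k-1. (real j)\<^sup>2 * (real (k - 1) + 1 - real j) powr q)"
    by (rule sum.reindex_bij_witness[of _ "\<lambda>j. k - j" "\<lambda>\<Delta>. k - \<Delta>"]) (auto simp: of_nat_diff)
  also have "\<dots> = (\<Sum>j=1..k-1. (real j)\<^sup>2 * ((real (k - 1) + 1 - real j) / real (k - 1)) powr q * real (k - 1) powr q)"
    using assms by (intro sum.cong refl) (simp add: powr_divide of_nat_diff)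
  also have "\<dots> = power_index_inv q (k - 1) * real (k - 1) powr q"
    unfolding power_index_inv_def by (simp only: sum_distrib_right)
  finally have eq: "(\<Sum>\<Delta>=1..k-1. (real (k - \<Delta>))\<^sup>2 * real \<Delta> powr q) = power_index_inv q (k - 1) * real (k - 1) powr q" .
  have "real (k - 1) powr q \<noteq> 0" using assms by simp
  then show ?thesis unfolding eq by simp
qed

text \<open>The base of each power is \<open>1 - (j - 1) / m\<close>, nondecreasing in
  \<open>m\<close>; strictness comes from the additional summands, the one at \<open>j = n\<close>
  being positive.\<close>

lemma power_index_inv_less:
  assumes "0 \<le> q" "1 \<le> m" "m < n"
  shows "power_index_inv q m < power_index_inv q n"
proof -
  have "power_index_inv q m \<le> (\<Sum>j=1..m. (real j)\<^sup>2 * ((real n + 1 - real j) / real n) powr q)"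
    unfolding power_index_inv_def
  proof (intro sum_mono mult_left_mono powr_mono2 assms)
    fix j assume j: "j \<in> {1..m}"
    have "(real j - 1) * real m \<le> (real j - 1) * real n"
      using j assms by (intro mult_left_mono) auto
    then show "(real m + 1 - real j) / real m \<le> (real n + 1 - real j) / real n"
      using assms by (simp add: field_simps)
    show "0 \<le> (real m + 1 - real j) / real m" using j by simp
  qed simp
  also have "\<dots> < power_index_inv q n"
    unfolding power_index_inv_def
  proof (rule sum_strict_mono2)
    show "n \<in> {1..n} - {1..m}" using assms by auto
    show "0 < (real n)\<^sup>2 * ((real n + 1 - real n) / real n) powr q" using assms by simp
  qed (use assms in auto)
  finally show ?thesis .
qed

lemma power_index_inv_le:
  assumes "0 \<le> q" "1 \<le> m"
  shows "power_index_inv q m \<le> real m ^ 3"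
proof -
  have "power_index_inv q m \<le> (\<Sum>j=1..m. (real m)\<^sup>2 * 1)"
    unfolding power_index_inv_def
    using assms by (intro sum_mono mult_mono power_mono) (auto intro!: powr_le_one_le simp: powr_le1)
  then show ?thesis by (simp add: power2_eq_square power3_eq_cube)
qed

lemma power_index_inv_ge:
  assumes "0 \<le> q" "1 \<le> m"
  shows "(real m / 4) ^ 3 * (1 / 2) powr q \<le> power_index_inv q m"
proof -
  \<comment> \<open>Only the indices \<open>n + 1\<close> to \<open>2 * n + 1\<close> are kept:
    there are at least \<open>m / 4\<close> of them, each is at least \<open>m / 4\<close>, and each
    has ratio at least \<open>(m - 2 * n) / m \<ge> 1 / 2\<close>. The offset keeps the range
    nonempty for \<open>m < 4\<close>.\<close>
  define n where "n = m div 4"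
  have n: "real m / 4 \<le> real n + 1" "2 * n + 1 \<le> m" "2 * real n \<le> real m / 2"
    using assms by (auto simp: n_def)
  have "(real m / 4) ^ 3 * (1 / 2) powr q \<le> real (n + 1) * ((real m / 4)\<^sup>2 * (1 / 2) powr q)"
    using mult_right_mono[OF n(1), of "(real m / 4)\<^sup>2 * (1 / 2) powr q"]
    by (simp add: power2_eq_square power3_eq_cube algebra_simps)
  also have "\<dots> = (\<Sum>j=n+1..2*n+1. (real m / 4)\<^sup>2 * (1 / 2) powr q)" by simp
  also have "\<dots> \<le> (\<Sum>j=n+1..2*n+1. (real j)\<^sup>2 * ((real m + 1 - real j) / real m) powr q)"
  proof (intro sum_mono mult_mono power_mono powr_mono2 assms)
    fix j assume j: "j \<in> {n+1..2*n+1}"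
    then have "real n + 1 \<le> real j" "real j \<le> 2 * real n + 1" by auto
    with n show "real m / 4 \<le> real j" "1 / 2 \<le> (real m + 1 - real j) / real m"
      using assms by (auto simp: field_simps)
  qed auto
  also have "\<dots> \<le> power_index_inv q m"
    unfolding power_index_inv_def by (rule sum_mono2) (use n in auto)
  finally show ?thesis .
qed

lemma power_index_inv_pos:
  assumes "0 \<le> q" "1 \<le> m"
  shows "0 < power_index_inv q m"
proof -
  have "0 < (real m / 4) ^ 3 * (1 / 2) powr q" using assms by simp
  then show ?thesis using power_index_inv_ge[OF assms] by linarith
qed

lemma power_index_bigtheta:
  assumes q: "0 \<le> q"
  shows "(\<lambda>k. 1 / power_index_inv q (k - 1)) \<in> \<Theta>(\<lambda>k. 1 / real k ^ 3)"
proof (rule bigthetaI)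
  \<comment> \<open>The \<open>1/4\<close> of the lower bound becomes \<open>1/8\<close> through
    \<open>k - 1 \<ge> k / 2\<close>, valid from \<open>k = 2\<close> on.\<close>
  define c :: real where "c = (1 / 8) ^ 3 * (1 / 2) powr q"
  have c: "0 < c" by (simp add: c_def)
  have lower: "c * real k ^ 3 \<le> power_index_inv q (k - 1)" and upper: "power_index_inv q (k - 1) \<le> real k ^ 3"
    if k: "2 \<le> k" for k
  proof -
    have "(real k / 8) ^ 3 \<le> (real (k - 1) / 4) ^ 3"
      using k by (intro power_mono) (auto simp: of_nat_diff)
    then have "(real k / 8) ^ 3 * (1 / 2) powr q \<le> (real (k - 1) / 4) ^ 3 * (1 / 2) powr q"
      by (intro mult_right_mono) auto
    also have "\<dots> \<le> power_index_inv q (k - 1)" using k by (intro power_index_inv_ge q) auto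
    finally show "c * real k ^ 3 \<le> power_index_inv q (k - 1)"
      by (simp add: c_def power_divide mult_ac)
    have "power_index_inv q (k - 1) \<le> real (k - 1) ^ 3" using k by (intro power_index_inv_le q) auto
    also have "\<dots> \<le> real k ^ 3" by (intro power_mono) auto
    finally show "power_index_inv q (k - 1) \<le> real k ^ 3" .
  qed
  have pos: "0 < power_index_inv q (k - 1)" if k: "2 \<le> k" for k
    using k by (intro power_index_inv_pos q) auto
  show "(\<lambda>k. 1 / power_index_inv q (k - 1)) \<in> O(\<lambda>k. 1 / real k ^ 3)"
  proof (rule bigoI[where c="1 / c"])
    show "\<forall>\<^sub>F k in sequentially. norm (1 / power_index_inv q (k - 1)) \<le> 1 / c * norm (1 / real k ^ 3)"
      using eventually_ge_at_top[of 2]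
    proof eventually_elim
      case (elim k)
      have "1 / power_index_inv q (k - 1) \<le> 1 / (c * real k ^ 3)"
        using lower[OF elim] pos[OF elim] c elim by (intro divide_left_mono) auto
      then show ?case using pos[OF elim] by simp
    qed
  qed
  show "(\<lambda>k. 1 / power_index_inv q (k - 1)) \<in> \<Omega>(\<lambda>k. 1 / real k ^ 3)"
  proof (rule landau_omega.bigI[where c=1])
    show "\<forall>\<^sub>F k in sequentially. norm (1 / power_index_inv q (k - 1)) \<ge> 1 * norm (1 / real k ^ 3)"
      using eventually_ge_at_top[of 2]
    proof eventually_elim
      case (elim k)
      have "1 / real k ^ 3 \<le> 1 / power_index_inv q (k - 1)"
        using upper[OF elim] pos[OF elim] elim by (intro divide_left_mono) auto
      then show ?case using pos[OF elim] by simp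
    qed
  qed simp
qed

theorem proposition4p7:
  fixes \<nu> :: "real measure" and M :: "'a measure" and X :: "nat \<Rightarrow> 'a \<Rightarrow> real" and p :: real
  defines "K \<equiv> trend_stat (\<lambda>\<Delta>. real \<Delta> powr p)"
  assumes "prob_space \<nu>" and "sets \<nu> = sets borel" and "absolutely_continuous lborel \<nu>"
    and "prob_space M"
    and "prob_space.indep_vars M (\<lambda>_. borel) X {1..}"
    and "\<And>i. i \<ge> 1 \<Longrightarrow> distr M borel (X i) = \<nu>"
    and "p \<ge> 0"
  shows "strict_antimono_on {2..} (\<lambda>k. incr_index \<nu> M X k (K k)) \<and>
    (\<forall>k\<ge>2. incr_index \<nu> M X k (K k) =
       real (k - 1) powr (2 * p) /
       (\<Sum>\<Delta>=1..k-1. (real (k - \<Delta>))\<^sup>2 * real \<Delta> powr (2 * p))) \<and>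
    (\<lambda>k. incr_index \<nu> M X k (K k)) \<in> \<Theta>(\<lambda>k. 1 / real k ^ 3)"
proof -
  interpret atomless_law \<nu>
  proof (intro atomless_law.intro law.intro law_axioms.intro atomless_law_axioms.intro assms(2,3))
    fix a :: real
    have "{a} \<in> null_sets lborel" by (simp add: null_sets_def)
    then show "emeasure \<nu> {a} = 0" using assms(4) by (auto simp: absolutely_continuous_def)
  qed
  have sq: "(x powr p)\<^sup>2 = x powr (2 * p)" for x :: real
    by (simp add: power2_eq_square powr_add[symmetric])
  have formula: "incr_index \<nu> M X k (K k) = real (k - 1) powr (2 * p) /
      (\<Sum>\<Delta>=1..k-1. (real (k - \<Delta>))\<^sup>2 * real \<Delta> powr (2 * p))" if "2 \<le> k" for k
    unfolding K_def sq[symmetric] by (rule incr_index_trend_stat[OF that assms(5,6)]) (rule assms(7))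
  \<comment> \<open>Decrease and growth rate are now statements about the reciprocal of a strictly
    increasing positive sequence.\<close>
  then have inv: "incr_index \<nu> M X k (K k) = 1 / power_index_inv (2 * p) (k - 1)" if "2 \<le> k" for k
    using power_index_eq[OF that] that by simp
  have q: "0 \<le> 2 * p" using assms(8) by simp
  have "strict_antimono_on {2..} (\<lambda>k. incr_index \<nu> M X k (K k))"
  proof (rule monotone_onI)
    fix k l :: nat assume kl: "k \<in> {2..}" "l \<in> {2..}" "k < l"
    then have "0 < power_index_inv (2 * p) (k - 1)" by (intro power_index_inv_pos q) auto
    moreover have "power_index_inv (2 * p) (k - 1) < power_index_inv (2 * p) (l - 1)"
      using kl by (intro power_index_inv_less q) auto
    ultimately show "incr_index \<nu> M X l (K l) < incr_index \<nu> M X k (K k)"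
      using kl by (simp add: inv frac_less2)
  qed
  moreover have "(\<lambda>k. incr_index \<nu> M X k (K k)) \<in> \<Theta>(\<lambda>k. 1 / real k ^ 3)"
  proof -
    \<comment> \<open>The formula holds from \<open>k = 2\<close> on, which suffices because the
      order of growth depends on eventual values only.\<close>
    have "\<forall>\<^sub>F k in sequentially. incr_index \<nu> M X k (K k) = 1 / power_index_inv (2 * p) (k - 1)"
      using eventually_ge_at_top[of 2] by eventually_elim (rule inv)
    then show ?thesis using power_index_bigtheta[OF q] by (subst landau_theta.in_cong)
  qed
  ultimately show ?thesis using formula by blast
qed

end
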